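(* Let $\widetilde T_B$ be the Shiryaev--Roberts procedure. Let $\bar\nu=\sum_{j=1}^\infty j\,\pi_j<\infty$. Let $r\ge1$. Assume that for some number $0<I<\infty$ $$\lim_{M\to\infty}\mathsf{P}_k\Big(\frac1M\max_{1\le n\le M}\lambda_{k+n}^k\ge(1+\varepsilon)I\Big)=0\quad\text{for all }\varepsilon>0\text{ and all }k\in\mathbb{Z}_+,$$ and $$\sum_{k=0}^\infty\pi_k\,\Upsilon_{k,r}(\varepsilon)<\infty\quad\text{for all }\varepsilon>0,\qquad\text{where } \Upsilon_{k,r}(\varepsilon)=\sum_{n=1}^\infty n^{r-1}\mathsf{P}_k\Big(\frac1n\lambda_{k+n}^k<I-\varepsilon\Big).$$ (i) Then for all $0<m\le r$ $$\lim_{B\to\infty}\frac{\mathsf{E}^\pi[(\widetilde T_B-\nu)^m\mid\widetilde T_B>\nu]}{(\log B)^m}=\frac1{I^m}.$$ (ii) Let $B=B_\alpha=\bar\nu/\alpha$. Then $\widetilde T_{B_\alpha}\in\mathbb{C}_\alpha$ and for all $0<m\le r$ $$\lim_{\alpha\to0}\frac{\mathsf{E}^\pi[(\widetilde T_{B_\alpha}-\nu)^m\mid\widetilde T_{B_\alpha}>\nu]}{|\log\alpha|^m}=\frac1{I^m}.$$ This last assertion also holds if $B=B_\alpha$ is selected so that $\mathsf{PFA}(\widetilde T_{B_\alpha})\le\alpha$ and $\log B_\alpha\sim|\log\alpha|$ as $\alpha\to0$.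
   Context: Model. $\mathbb{Z}_+=\{0,1,2,\dots\}$. Observations $X_1,X_2,\dots$ are random variables on a measurable space $(\Omega,\mathscr{F})$; $\mathbf{X}^n=(X_1,\dots,X_n)$, $\mathscr{F}_n=\sigma(\mathbf{X}^n)$. $\mathsf{P}_\infty$ (no change) and $\mathsf{P}_0$ are probability measures whose restrictions to $\mathscr{F}_n$ are mutually absolutely continuous for every $n\ge1$, with conditional densities $p_j(X_i|\mathbf{X}^{i-1})$, $j=\infty,0$, with respect to a $\sigma$-finite measure (these may depend on $i$, and $p_0(X_i|\mathbf{X}^{i-1})$ for $i>\nu$ may also depend on the change point $\nu$; this dependence is suppressed in the notation). No independence or identical distribution is assumed. For $k\in\mathbb{Z}_+$, $\mathsf{P}_k$ (expectation $\mathsf{E}_k$) is the measure when the change point is $\nu=k$ ($k$ is the index of the last pre-change observation), under which $\mathbf{X}^n$ has density $\prod_{i=1}^{k}p_\infty(X_i|\mathbf{X}^{i-1})\prod_{i=k+1}^n p_0(X_i|\mathbf{X}^{i-1})$ for $n>k$ and $\prod_{i=1}^n p_\infty(X_i|\mathbf{X}^{i-1})$ for $n\le k$. Prior. The change point $\nu$ is integer valued with prior $\pi_k=\mathsf{P}(\nu=k)$ for $k\in\mathbb{Z}_+$, $q=\mathsf{P}(\nu<0)\in[0,1)$ (the prior on negative integers matters only through $q$). Log-likelihood ratios. $\mathcal{L}_i=p_0(X_i|\mathbf{X}^{i-1})/p_\infty(X_i|\mathbf{X}^{i-1})$, $Z_i=\log\mathcal{L}_i$, $\lambda_{k+n}^k=\sum_{i=k+1}^{k+n}Z_i$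 for $n\ge1$. Detection procedures. A detection procedure is a stopping time $T\geq 1$ (possibly infinite) with respect to $\{\mathscr{F}_n\}$. Its weighted probability of false alarm is $\mathsf{PFA}(T)=\sum_{k=1}^\infty\pi_k\mathsf{P}_\infty(T\le k)$, and $\mathbb{C}_\alpha=\{T:\mathsf{PFA}(T)\le\alpha\}$ for $0<\alpha<1$. With $\mathsf{P}^\pi(\mathcal{A}\times J)=\sum_{k\in J}\pi_k\mathsf{P}_k(\mathcal{A})$ for $J\subseteq\mathbb{Z}_+$, the conditional moments of the delay are $\mathsf{E}^\pi[(T-\nu)^m\mid T>\nu]=\sum_{k\ge0}\pi_k\mathsf{E}_k[((T-k)^+)^m]\big/\sum_{k\ge0}\pi_k\mathsf{P}_\infty(T>k)$. Shiryaev--Roberts procedure. $\widetilde T_B=\inf\{n\ge1:R_n\ge B\}$, $B>0$, where $R_n=\sum_{k=1}^n\prod_{i=k}^n\mathcal{L}_i$, $R_0=0$. $f\sim g$ means that the ratio $f/g$ tends to $1$. *)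

theory Defs
  imports "HOL-Probability.Probability"
begin

text \<open>
  The observations \<open>X i\<close>, \<open>i \<ge> 1\<close>, take values in the measurable space underlying the dominating
  \<open>\<sigma>\<close>-finite measure \<open>mu\<close>. A history \<open>(X 1, \<dots>, X (i - 1))\<close> is a point of the product space
  over the index set \<open>{1..<i}\<close>, and a conditional density \<open>p(X i | X 1, \<dots>, X (i - 1))\<close> is a
  function \<open>p i h x\<close> of the history \<open>h\<close> and the new value \<open>x\<close>. The post-change density \<open>p0 k i\<close>
  may depend on the change point \<open>k\<close>; only its values for \<open>i > k\<close> matter.
\<close>

definition history :: "(nat \<Rightarrow> 'w \<Rightarrow> 's) \<Rightarrow> nat \<Rightarrow> 'w \<Rightarrow> nat \<Rightarrow> 's" where
  "history X i \<omega> = (\<lambda>j\<in>{1..<i}. X j \<omega>)"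

text \<open>The filtration is indexed by \<^typ>\<open>enat\<close> so that stopping times may be infinite; at \<open>\<infinity>\<close> it
  is the \<open>\<sigma>\<close>-algebra generated by all observations.\<close>

definition obs_filtration ::
  "'w measure \<Rightarrow> 's measure \<Rightarrow> (nat \<Rightarrow> 'w \<Rightarrow> 's) \<Rightarrow> enat \<Rightarrow> 'w measure" where
  "obs_filtration M mu X v =
     vimage_algebra (space M) (\<lambda>\<omega>. \<lambda>i\<in>{i. 1 \<le> i \<and> enat i \<le> v}. X i \<omega>)
       (PiM {i. 1 \<le> i \<and> enat i \<le> v} (\<lambda>_. mu))"

text \<open>Joint densities of \<open>(X 1, \<dots>, X n)\<close> with respect to the \<open>n\<close>-fold product of \<open>mu\<close>.\<close>

definition joint_density_inf ::
  "(nat \<Rightarrow> (nat \<Rightarrow> 's) \<Rightarrow> 's \<Rightarrow> real) \<Rightarrow> nat \<Rightarrow> (nat \<Rightarrow> 's) \<Rightarrow> real" where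
  "joint_density_inf pinf n x = (\<Prod>i=1..n. pinf i (restrict x {1..<i}) (x i))"

definition joint_density ::
  "(nat \<Rightarrow> (nat \<Rightarrow> 's) \<Rightarrow> 's \<Rightarrow> real) \<Rightarrow> (nat \<Rightarrow> nat \<Rightarrow> (nat \<Rightarrow> 's) \<Rightarrow> 's \<Rightarrow> real)
     \<Rightarrow> nat \<Rightarrow> nat \<Rightarrow> (nat \<Rightarrow> 's) \<Rightarrow> real" where
  "joint_density pinf p0 k n x =
     (if n \<le> k then \<Prod>i=1..n. pinf i (restrict x {1..<i}) (x i)
      else (\<Prod>i=1..k. pinf i (restrict x {1..<i}) (x i)) *
           (\<Prod>i=k+1..n. p0 k i (restrict x {1..<i}) (x i)))"

text \<open>
  \<open>Pinf\<close> is the no-change measure and \<open>P k\<close> the measure with change point \<open>k\<close> (the index of the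
  last pre-change observation). That \<open>pinf i\<close> and \<open>p0 k i\<close> are conditional densities of \<open>X i\<close> given
  the history is expressed by the formulas for the joint densities for all \<open>n\<close>; normalization
  (almost surely) follows from these by comparing \<open>n\<close> with \<open>n + 1\<close>. If \<open>p0\<close> does not depend on the
  change point, mutual absolute continuity of \<open>P k\<close> and \<open>Pinf\<close> on the history for every \<open>k\<close> is
  equivalent to that for \<open>k = 0\<close>.
\<close>

locale changepoint_model =
  fixes M :: "'w measure"
    and mu :: "'s measure"
    and X :: "nat \<Rightarrow> 'w \<Rightarrow> 's"
    and pinf :: "nat \<Rightarrow> (nat \<Rightarrow> 's) \<Rightarrow> 's \<Rightarrow> real"
    and p0 :: "nat \<Rightarrow> nat \<Rightarrow> (nat \<Rightarrow> 's) \<Rightarrow> 's \<Rightarrow> real"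
    and Pinf :: "'w measure"
    and P :: "nat \<Rightarrow> 'w measure"
  assumes sigma_finite_mu: "sigma_finite_measure mu"
    and X_measurable: "\<And>i. 1 \<le> i \<Longrightarrow> X i \<in> measurable M mu"
    and pinf_nonneg: "\<And>i h x. 1 \<le> i \<Longrightarrow> 0 \<le> pinf i h x"
    and pinf_measurable: "\<And>i. 1 \<le> i \<Longrightarrow>
          (\<lambda>(h, x). pinf i h x) \<in> borel_measurable (PiM {1..<i} (\<lambda>_. mu) \<Otimes>\<^sub>M mu)"
    and p0_nonneg: "\<And>k i h x. k < i \<Longrightarrow> 0 \<le> p0 k i h x"
    and p0_measurable: "\<And>k i. k < i \<Longrightarrow>
          (\<lambda>(h, x). p0 k i h x) \<in> borel_measurable (PiM {1..<i} (\<lambda>_. mu) \<Otimes>\<^sub>M mu)"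
    and prob_space_Pinf: "prob_space Pinf"
    and sets_Pinf: "sets Pinf = sets M"
    and prob_space_P: "\<And>k. prob_space (P k)"
    and sets_P: "\<And>k. sets (P k) = sets M"
    and density_Pinf: "\<And>n. 1 \<le> n \<Longrightarrow>
          distributed Pinf (PiM {1..n} (\<lambda>_. mu)) (\<lambda>\<omega>. \<lambda>i\<in>{1..n}. X i \<omega>)
            (\<lambda>x. ennreal (joint_density_inf pinf n x))"
    and density_P: "\<And>k n. 1 \<le> n \<Longrightarrow>
          distributed (P k) (PiM {1..n} (\<lambda>_. mu)) (\<lambda>\<omega>. \<lambda>i\<in>{1..n}. X i \<omega>)
            (\<lambda>x. ennreal (joint_density pinf p0 k n x))"
    and ac_Pinf_P: "\<And>k n. 1 \<le> n \<Longrightarrow>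
          absolutely_continuous (restr_to_subalg Pinf (obs_filtration M mu X (enat n)))
            (restr_to_subalg (P k) (obs_filtration M mu X (enat n)))"
    and ac_P_Pinf: "\<And>k n. 1 \<le> n \<Longrightarrow>
          absolutely_continuous (restr_to_subalg (P k) (obs_filtration M mu X (enat n)))
            (restr_to_subalg Pinf (obs_filtration M mu X (enat n)))"

text \<open>Likelihood ratio of the \<open>i\<close>-th observation (\<open>i > k\<close>) for change point \<open>k\<close>. By mutual absolute
  continuity, the conventions for division by zero and the logarithm of zero matter on null sets
  only.\<close>

definition lik_ratio ::
  "(nat \<Rightarrow> 'w \<Rightarrow> 's) \<Rightarrow> (nat \<Rightarrow> (nat \<Rightarrow> 's) \<Rightarrow> 's \<Rightarrow> real)
     \<Rightarrow> (nat \<Rightarrow> nat \<Rightarrow> (nat \<Rightarrow> 's) \<Rightarrow> 's \<Rightarrow> real) \<Rightarrow> nat \<Rightarrow> nat \<Rightarrow> 'w \<Rightarrow> real" where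
  "lik_ratio X pinf p0 k i \<omega> =
     p0 k i (history X i \<omega>) (X i \<omega>) / pinf i (history X i \<omega>) (X i \<omega>)"

text \<open>\<open>llr X pinf p0 k n\<close> is the sum over the \<open>n\<close> observations following \<open>k\<close>.\<close>

definition llr ::
  "(nat \<Rightarrow> 'w \<Rightarrow> 's) \<Rightarrow> (nat \<Rightarrow> (nat \<Rightarrow> 's) \<Rightarrow> 's \<Rightarrow> real)
     \<Rightarrow> (nat \<Rightarrow> nat \<Rightarrow> (nat \<Rightarrow> 's) \<Rightarrow> 's \<Rightarrow> real) \<Rightarrow> nat \<Rightarrow> nat \<Rightarrow> 'w \<Rightarrow> real" where
  "llr X pinf p0 k n \<omega> = (\<Sum>i=k+1..k+n. ln (lik_ratio X pinf p0 k i \<omega>))"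

text \<open>The \<open>k\<close>-th summand is the likelihood ratio of the hypothesis that observation \<open>k\<close> is the
  first post-change one, i.e. that the change point is \<open>k - 1\<close>.\<close>

definition SR_stat ::
  "(nat \<Rightarrow> 'w \<Rightarrow> 's) \<Rightarrow> (nat \<Rightarrow> (nat \<Rightarrow> 's) \<Rightarrow> 's \<Rightarrow> real)
     \<Rightarrow> (nat \<Rightarrow> nat \<Rightarrow> (nat \<Rightarrow> 's) \<Rightarrow> 's \<Rightarrow> real) \<Rightarrow> nat \<Rightarrow> 'w \<Rightarrow> real" where
  "SR_stat X pinf p0 n \<omega> = (\<Sum>k=1..n. \<Prod>i=k..n. lik_ratio X pinf p0 (k - 1) i \<omega>)"

definition SR_time ::
  "(nat \<Rightarrow> 'w \<Rightarrow> 's) \<Rightarrow> (nat \<Rightarrow> (nat \<Rightarrow> 's) \<Rightarrow> 's \<Rightarrow> real)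
     \<Rightarrow> (nat \<Rightarrow> nat \<Rightarrow> (nat \<Rightarrow> 's) \<Rightarrow> 's \<Rightarrow> real) \<Rightarrow> real \<Rightarrow> 'w \<Rightarrow> enat" where
  "SR_time X pinf p0 B \<omega> = Inf {enat n |n. 1 \<le> n \<and> B \<le> SR_stat X pinf p0 n \<omega>}"

text \<open>The prior is a distribution on the integers, whose restriction to the nonnegative integers
  is \<open>\<pi>\<close>. Sums over \<open>k \<ge> 1\<close> are written as sums over \<^term>\<open>Suc k\<close>.\<close>

abbreviation prior_at :: "int pmf \<Rightarrow> nat \<Rightarrow> real" where
  "prior_at prior k \<equiv> pmf prior (int k)"

definition prior_mean :: "int pmf \<Rightarrow> real" where
  "prior_mean prior = (\<Sum>j. real (Suc j) * prior_at prior (Suc j))"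

definition PFA :: "'w measure \<Rightarrow> int pmf \<Rightarrow> ('w \<Rightarrow> enat) \<Rightarrow> real" where
  "PFA Pinf prior T = (\<Sum>k. prior_at prior (Suc k) * \<P>(\<omega> in Pinf. T \<omega> \<le> enat (Suc k)))"

definition detection_procedure ::
  "'w measure \<Rightarrow> 's measure \<Rightarrow> (nat \<Rightarrow> 'w \<Rightarrow> 's) \<Rightarrow> ('w \<Rightarrow> enat) \<Rightarrow> bool" where
  "detection_procedure M mu X T \<longleftrightarrow>
     stopping_time (obs_filtration M mu X) T \<and> (\<forall>\<omega>\<in>space M. 1 \<le> T \<omega>)"

definition PFA_class ::
  "'w measure \<Rightarrow> 's measure \<Rightarrow> (nat \<Rightarrow> 'w \<Rightarrow> 's) \<Rightarrow> 'w measure \<Rightarrow> int pmf \<Rightarrow> real \<Rightarrow> ('w \<Rightarrow> enat) set"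
  where
  "PFA_class M mu X Pinf prior \<alpha> = {T. detection_procedure M mu X T \<and> PFA Pinf prior T \<le> \<alpha>}"

fun enat_powr :: "enat \<Rightarrow> real \<Rightarrow> ennreal" where
  "enat_powr (enat n) m = ennreal (real n powr m)"
| "enat_powr \<infinity> m = \<infinity>"

text \<open>Conditional \<open>m\<close>-th moment of the detection delay given \<open>T > \<nu>\<close>, possibly infinite. Subtraction
  on \<^typ>\<open>enat\<close> is truncated, so \<open>T \<omega> - enat k\<close> is the positive part of the delay; \<open>0 * \<infinity> = 0\<close> in
  \<^typ>\<open>ennreal\<close>.\<close>

definition cond_delay_moment ::
  "'w measure \<Rightarrow> (nat \<Rightarrow> 'w measure) \<Rightarrow> int pmf \<Rightarrow> ('w \<Rightarrow> enat) \<Rightarrow> real \<Rightarrow> ennreal" where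
  "cond_delay_moment Pinf P prior T m =
     (\<Sum>k. ennreal (prior_at prior k) * (\<integral>\<^sup>+\<omega>. enat_powr (T \<omega> - enat k) m \<partial>P k)) /
     ennreal (\<Sum>k. prior_at prior k * \<P>(\<omega> in Pinf. enat k < T \<omega>))"

definition Upsilon ::
  "(nat \<Rightarrow> 'w \<Rightarrow> 's) \<Rightarrow> (nat \<Rightarrow> (nat \<Rightarrow> 's) \<Rightarrow> 's \<Rightarrow> real)
     \<Rightarrow> (nat \<Rightarrow> nat \<Rightarrow> (nat \<Rightarrow> 's) \<Rightarrow> 's \<Rightarrow> real) \<Rightarrow> (nat \<Rightarrow> 'w measure)
     \<Rightarrow> real \<Rightarrow> nat \<Rightarrow> real \<Rightarrow> real \<Rightarrow> ennreal" where
  "Upsilon X pinf p0 P I k r \<epsilon> =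
     (\<Sum>n. ennreal (real (Suc n) powr (r - 1) *
        \<P>(\<omega> in P k. llr X pinf p0 k (Suc n) \<omega> / real (Suc n) < I - \<epsilon>)))"

end

theory Submission
  imports Defs "HOL-Real_Asymp.Real_Asymp"
begin

text \<open>
  On \<open>\<sigma>(X 1, \<dots>, X n)\<close> the partial products of the likelihood ratios are the densities of \<open>P k\<close> with
  respect to \<open>Pinf\<close>. On \<open>T = n\<close> the statistic is at least \<open>B\<close>, so
  \<open>B Pinf (T = n) \<le> (\<Sum>k<n. P k (T = n))\<close>, and summation over \<open>n \<le> K\<close> gives \<open>Pinf (T \<le> K) \<le> K / B\<close>.
  This bounds the probability of false alarm and makes the normalization of the conditional moments
  converge to the prior mass of the nonnegative integers.

  For the lower bound on the moments, alarms in \<open>{k<..k+N}\<close> with \<open>N \<approx> \<theta> log B / I\<close>, \<open>\<theta> < 1\<close>, and with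
  log-likelihood ratio below \<open>c = (1 + \<epsilon>) I N\<close> have \<open>P k\<close>-probability at most
  \<open>exp c * Pinf (T \<le> k + N) \<le> exp c * (k + N) / B\<close>, which vanishes as soon as \<open>(1 + \<epsilon>) \<theta> < 1\<close>; a larger
  log-likelihood ratio is excluded by the upper law-of-large-numbers condition. For the upper bound,
  the statistic dominates its \<open>k\<close>-th summand, so \<open>T - k > n\<close> forces the log-likelihood ratio after \<open>n\<close>
  steps below \<open>log B\<close>, hence below \<open>(I - \<epsilon>) n\<close> once \<open>n \<ge> log B / (I - \<epsilon>)\<close>; the tail of the moment is then
  controlled by \<open>Upsilon\<close>, independently of \<open>B\<close>.
\<close>

section \<open>Elementary estimates and limits\<close>

lemma coord_measurable:
  assumes "1 \<le> i" "i \<le> n" and f: "(\<lambda>(h, x). f h x) \<in> borel_measurable (PiM {1..<i} (\<lambda>_. mu) \<Otimes>\<^sub>M mu)"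
  shows "(\<lambda>x. f (restrict x {1..<i}) (x i)) \<in> borel_measurable (PiM {1..n::nat} (\<lambda>_. mu))"
proof -
  have 1: "(\<lambda>x. restrict x {1..<i}) \<in> measurable (PiM {1..n} (\<lambda>_. mu)) (PiM {1..<i} (\<lambda>_. mu))"
    using assms by (intro measurable_restrict_subset) auto
  have 2: "(\<lambda>x. x i) \<in> measurable (PiM {1..n} (\<lambda>_. mu)) mu"
    using assms by (intro measurable_component_singleton) auto
  have "(\<lambda>x. (restrict x {1..<i}, x i))
      \<in> measurable (PiM {1..n} (\<lambda>_. mu)) (PiM {1..<i} (\<lambda>_. mu) \<Otimes>\<^sub>M mu)"
    using 1 2 by measurable
  from measurable_compose[OF this f] show ?thesis by simp
qed

section \<open>Power increments and tail sums for moments\<close>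

text \<open>By the mean value theorem the increment is \<open>m * z powr (m - 1)\<close> with
  \<open>z\<close> between \<open>n\<close> and \<open>Suc n\<close>. Since \<open>z > 1\<close>,
  the exponent may be raised to \<open>r - 1\<close>, which also covers \<open>m < 1\<close> and
  yields the weights of \<open>Upsilon\<close>; since \<open>n \<ge> 1\<close>,
  \<open>z < 2 * n\<close>, whence the power of 2.\<close>

lemma powr_Suc_diff_le:
  fixes m r :: real and n :: nat
  assumes "0 < m" "m \<le> r" "1 \<le> r" "1 \<le> n"
  shows "real (Suc n) powr m - real n powr m \<le> r * 2 powr (r - 1) * real n powr (r - 1)"
proof -
  have "\<exists>z. real n < z \<and> z < real (Suc n) \<and>
      real (Suc n) powr m - real n powr m = (real (Suc n) - real n) * (m * z powr (m - 1))"
    using assms by (intro MVT2[of "real n" "real (Suc n)"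
        "\<lambda>x. x powr m"]) (auto intro!: has_real_derivative_powr)
  then obtain z where z: "real n < z" "z < real (Suc n)"
    "real (Suc n) powr m - real n powr m = m * z powr (m - 1)" by auto
  have "z powr (m - 1) \<le> z powr (r - 1)" using assms z by (intro powr_mono) auto
  also have "\<dots> \<le> (2 * real n) powr (r - 1)" using assms z by (intro powr_mono2) auto
  also have "\<dots> = 2 powr (r - 1) * real n powr (r - 1)" by (simp add: powr_mult)
  finally have "z powr (m - 1) \<le> 2 powr (r - 1) * real n powr (r - 1)" .
  then have "m * z powr (m - 1) \<le> r * (2 powr (r - 1) * real n powr (r - 1))"
    using assms by (intro mult_mono) auto
  then show ?thesis using z by (simp add: mult.assoc)
qed

text \<open>A discrete layer-cake bound: the \<open>m\<close>-th power telescopes from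
  \<open>Suc N\<close> upwards, and each increment is paid for by the indicator that
  \<open>t\<close> exceeds it. Integrated termwise, it turns a moment into a weighted sum of tail
  probabilities.\<close>

lemma enat_powr_le_tail_sum:
  fixes m r :: real
  assumes "0 < m" "m \<le> r" "1 \<le> r"
  shows "enat_powr t m \<le> ennreal (real (Suc N) powr m) +
    (\<Sum>n. ennreal (r * 2 powr (r - 1) * real (Suc n) powr (r - 1)) * indicator {n. N \<le> n \<and> enat (Suc n)
        < t} n)"
    (is "_ \<le> _ + (\<Sum>n. ?c n * ?ind t n)")
proof (cases t)
  have fin: "ennreal (real j powr m) \<le> ennreal (real (Suc N) powr m) + (\<Sum>n. ?c n * ?ind (enat j) n)"
    for j
  proof (cases "j \<le> Suc N")
    case True
    then have "ennreal (real j powr m) \<le> ennreal (real (Suc N) powr m)"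
      using assms by (intro ennreal_leI powr_mono2) auto
    then show ?thesis by (rule order_trans) simp
  next
    case False
    then obtain i where j: "j = Suc i" and i: "N < i" by (metis not_le Suc_less_eq Suc_lessE)
    have "real j powr m = real (Suc N) powr m
        + (\<Sum>n=N..<i. real (Suc (Suc n)) powr m - real (Suc n) powr m)"
      using sum_Suc_diff'[of N i "\<lambda>n. real (Suc n) powr m"] i j by simp
    also have "\<dots> \<le> real (Suc N) powr m + (\<Sum>n=N..<i. r * 2 powr (r - 1) * real (Suc n) powr (r - 1))"
      by (intro add_left_mono sum_mono powr_Suc_diff_le assms) auto
    finally have "ennreal (real j powr m)
        \<le> ennreal (real (Suc N) powr m + (\<Sum>n=N..<i. r * 2 powr (r - 1) * real (Suc n) powr (r - 1)))"
      by (rule ennreal_leI)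
    also have "\<dots> = ennreal (real (Suc N) powr m) + (\<Sum>n=N..<i. ?c n)"
      using assms by (subst ennreal_plus) (auto intro!: sum_nonneg simp: sum_ennreal)
    also have "(\<Sum>n=N..<i. ?c n) = (\<Sum>n=N..<i. ?c n * ?ind (enat j) n)"
      by (intro sum.cong) (auto simp: j)
    also have "\<dots> \<le> (\<Sum>n. ?c n * ?ind (enat j) n)"
      by (intro sum_le_suminf) auto
    finally show ?thesis by (simp add: add_left_mono)
  qed
  {
    case (enat j)
    then show ?thesis using fin by simp
  next
    case infinity
    let ?R = "ennreal (real (Suc N) powr m) + (\<Sum>n. ?c n * ?ind \<infinity> n)"
    \<comment> \<open>The indicators grow with \<open>t\<close>, so the sum at \<infinity> dominates
      every finite case and can only be infinite.\<close>
    have le: "ennreal (real j powr m) \<le> ?R" for j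
      by (rule order_trans[OF fin]) (intro add_left_mono suminf_le mult_left_mono, auto simp:
          indicator_def)
    have "?R = top"
    proof (rule ccontr)
      assume "?R \<noteq> top"
      then obtain x where x: "0 \<le> x" "?R = ennreal x" by (cases ?R) auto
      \<comment> \<open>This \<open>j\<close> has \<open>m\<close>-th power at least
        \<open>x + 1\<close>, above the supposed finite value \<open>x\<close>.\<close>
      obtain j :: nat where j: "(x + 1) powr (1 / m) \<le> real j" using real_arch_simple by blast
      have "x + 1 = ((x + 1) powr (1 / m)) powr m" using x assms by (simp add: powr_powr)
      also have "\<dots> \<le> real j powr m" using j assms by (intro powr_mono2) auto
      also have "\<dots> \<le> x" using le[of j] x by simp
      finally show False by simp
    qed
    then show ?thesis using infinity by simp
  }
qed

text \<open>A squeeze with slack: for fixed \<open>j\<close> the two bounds need not have the same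
  limit along \<open>F\<close>; the gap closes only when \<open>j\<close> tends to infinity
  afterwards. It serves bounds in which an auxiliary slope is fixed before the threshold
  grows.\<close>

lemma tendsto_bound_families:
  fixes f :: "'a \<Rightarrow> 'b :: linorder_topology"
  assumes lower: "\<And>j::nat. \<forall>\<^sub>F x in F. l j x \<le> f x" "\<And>j. (l j \<longlongrightarrow> L j) F" "L \<longlonglongrightarrow> c"
    and upper: "\<And>j::nat. \<forall>\<^sub>F x in F. f x \<le> u j x" "\<And>j. (u j \<longlongrightarrow> U j) F" "U \<longlonglongrightarrow> c"
  shows "(f \<longlongrightarrow> c) F"
proof (rule order_tendstoI)
  fix y assume "y < c"
  then obtain j where "y < L j" using order_tendstoD(1)[OF lower(3)]
    by (metis eventually_sequentially order_refl)
  from order_tendstoD(1)[OF lower(2) this] lower(1)[of j]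
  show "\<forall>\<^sub>F x in F. y < f x" by eventually_elim (rule less_le_trans)
next
  fix y assume "c < y"
  then obtain j where "U j < y" using order_tendstoD(2)[OF upper(3)]
    by (metis eventually_sequentially order_refl)
  from order_tendstoD(2)[OF upper(2) this] upper(1)[of j]
  show "\<forall>\<^sub>F x in F. f x < y" by eventually_elim (rule le_less_trans)
qed

lemma enat_powr_ge:
  assumes "enat N < t" "0 < m"
  shows "ennreal (real N powr m) \<le> enat_powr t m"
  using assms by (cases t) (auto intro!: ennreal_leI powr_mono2)

lemma ennreal_divide_change_denominator:
  assumes "0 < u" "0 < v"
  shows "x / ennreal u = x / ennreal v * ennreal (v / u)"
proof -
  have "x / ennreal v * ennreal (v / u) = x * (ennreal (inverse v) * ennreal (v / u))"
    using assms by (simp add: divide_ennreal_def inverse_ennreal mult.assoc)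
  also have "ennreal (inverse v) * ennreal (v / u) = ennreal (inverse u)"
    using assms by (simp add: ennreal_mult'[symmetric] field_simps)
  finally show ?thesis using assms by (simp add: divide_ennreal_def inverse_ennreal)
qed

section \<open>Mass and mean of the prior on the nonnegative integers\<close>

lemma summable_prior: "summable (prior_at prior)"
  and suminf_prior: "(\<Sum>k. prior_at prior k) = measure_pmf.prob prior {0..}"
proof -
  have "(\<lambda>k. measure_pmf.prob prior {int k}) sums measure_pmf.prob prior (\<Union>k. {int k})"
    by (intro measure_pmf.finite_measure_UNION) (auto simp: disjoint_family_on_def)
  moreover have "(\<Union>k. {int k}) = {0..}"
    by (auto intro: nonneg_int_cases)
  ultimately have "prior_at prior sums measure_pmf.prob prior {0..}" by (simp add: measure_pmf_single)
  then show "summable (prior_at prior)" "(\<Sum>k. prior_at prior k) = measure_pmf.prob prior {0..}"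
    by (auto simp: sums_iff)
qed

lemma suminf_prior_pos:
  assumes "measure_pmf.prob prior {..<0::int} < 1"
  shows "0 < (\<Sum>k. prior_at prior k)"
proof -
  have "{0..} = (UNIV - {..<0::int})" by auto
  then have "measure_pmf.prob prior {0..} = 1 - measure_pmf.prob prior {..<0}"
    using measure_pmf.prob_compl[of "{..<0}" prior] by simp
  then show ?thesis using assms by (simp add: suminf_prior)
qed

text \<open>The added term at \<open>k = 0\<close> vanishes. In this form the mean matches the sums
  over all change points \<open>k \<ge> 0\<close>.\<close>

lemma prior_mean_altdef:
  assumes "summable (\<lambda>j. real (Suc j) * prior_at prior (Suc j))"
  shows "(\<lambda>k. prior_at prior k * real k) sums prior_mean prior"
proof -
  have "(\<lambda>j. prior_at prior (Suc j) * real (Suc j)) sums prior_mean prior"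
    using summable_sums[OF assms] by (simp add: prior_mean_def mult.commute)
  then show ?thesis by (subst (asm) sums_Suc_iff) simp
qed

text \<open>As \<open>ln (b \<alpha>)\<close> is equivalent to
  \<open>\<bar>ln \<alpha>\<bar>\<close>, it tends to infinity, and so does
  \<open>b \<alpha>\<close>; hence the limit in \<open>B\<close> may be composed with
  \<open>b\<close>. Exchanging the normalizations costs the \<open>m\<close>-th power of a ratio
  tending to 1. This transfers the limit in \<open>B\<close> to each choice of threshold depending
  on \<alpha>.\<close>

lemma tendsto_at_right_0_rescale:
  fixes f :: "real \<Rightarrow> ennreal" and m c :: real
  assumes f: "((\<lambda>B. f B / ennreal (ln B powr m)) \<longlongrightarrow> ennreal c) at_top"
    and b: "\<forall>\<^sub>F \<alpha> in at_right 0. 0 < b \<alpha>" "(\<lambda>\<alpha>. ln (b \<alpha>)) \<sim>[at_right 0] (\<lambda>\<alpha>. \<bar>ln \<alpha>\<bar>)"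
  shows "((\<lambda>\<alpha>. f (b \<alpha>) / ennreal (\<bar>ln \<alpha>\<bar> powr m)) \<longlongrightarrow> ennreal c) (at_right 0)"
proof -
  have ln_top: "filterlim (\<lambda>\<alpha>::real. \<bar>ln \<alpha>\<bar>) at_top (at_right 0)" by real_asymp
  have lnb_top: "filterlim (\<lambda>\<alpha>. ln (b \<alpha>)) at_top (at_right 0)"
    using asymp_equiv_at_top_transfer[OF asymp_equiv_symI[OF b(2)] ln_top] .
  have "filterlim (\<lambda>\<alpha>. exp (ln (b \<alpha>))) at_top (at_right 0)"
    by (rule filterlim_compose[OF exp_at_top lnb_top])
  then have b_top: "filterlim b at_top (at_right 0)"
    by (rule filterlim_mono_eventually[OF _ order_refl order_refl]) (use b(1) in eventually_elim, simp)
  have ln_pos: "\<forall>\<^sub>F \<alpha>::real in at_right 0. 0 < \<bar>ln \<alpha>\<bar>"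
    using ln_top by (simp only: filterlim_at_top_dense)
  have lnb_pos: "\<forall>\<^sub>F \<alpha> in at_right 0. 0 < ln (b \<alpha>)"
    using lnb_top by (simp only: filterlim_at_top_dense)
  have "((\<lambda>\<alpha>. ln (b \<alpha>) / \<bar>ln \<alpha>\<bar>) \<longlongrightarrow> 1) (at_right 0)"
    by (rule asymp_equivD_strong[OF b(2)]) (use ln_pos in eventually_elim, simp)
  then have "((\<lambda>\<alpha>. f (b \<alpha>) / ennreal (ln (b \<alpha>) powr m) * ennreal ((ln (b \<alpha>) / \<bar>ln \<alpha>\<bar>) powr m)) \<longlongrightarrow>
      ennreal c * ennreal (1 powr m)) (at_right 0)"
    by (intro tendsto_mult_ennreal filterlim_compose[OF f b_top] tendsto_ennrealI tendsto_powr
        tendsto_const) auto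
  then have "((\<lambda>\<alpha>. f (b \<alpha>) / ennreal (ln (b \<alpha>) powr m) * ennreal ((ln (b \<alpha>) / \<bar>ln \<alpha>\<bar>) powr m))
      \<longlongrightarrow> ennreal c) (at_right 0)"
    by simp
  then show ?thesis
  proof (rule Lim_transform_eventually)
    show "\<forall>\<^sub>F \<alpha> in at_right 0. f (b \<alpha>) / ennreal (ln (b \<alpha>) powr m) * ennreal ((ln (b \<alpha>) / \<bar>ln \<alpha>\<bar>) powr
        m) =
       f (b \<alpha>) / ennreal (\<bar>ln \<alpha>\<bar> powr m)"
      using ln_pos lnb_pos
    proof eventually_elim
      case (elim \<alpha>)
      then show ?case
        using ennreal_divide_change_denominator[of "\<bar>ln \<alpha>\<bar> powr m" "ln (b \<alpha>) powr m" "f (b \<alpha>)"]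
        by (simp add: powr_divide)
    qed
  qed
qed

section \<open>Change of measure\<close>

context changepoint_model
begin

lemma space_eq: "space (P k) = space M" "space Pinf = space M"
  using sets_P sets_Pinf sets_eq_imp_space_eq by blast+

section \<open>Joint densities and likelihood ratios on observation paths\<close>

definition obs :: "nat \<Rightarrow> 'w \<Rightarrow> nat \<Rightarrow> 's" where
  "obs n \<omega> = (\<lambda>i\<in>{1..n}. X i \<omega>)"

definition obs_space :: "nat \<Rightarrow> (nat \<Rightarrow> 's) measure" where
  "obs_space n = PiM {1..n} (\<lambda>_. mu)"

abbreviation "F n \<equiv> obs_filtration M mu X (enat n)"
abbreviation "LR k i \<equiv> lik_ratio X pinf p0 k i"
abbreviation "R n \<equiv> SR_stat X pinf p0 n"
abbreviation "T B \<equiv> SR_time X pinf p0 B"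

lemma joint_density_inf_measurable [measurable]:
  "joint_density_inf pinf n \<in> borel_measurable (obs_space n)"
  unfolding joint_density_inf_def[abs_def] obs_space_def
  by (intro borel_measurable_prod coord_measurable pinf_measurable) auto

lemma joint_density_measurable [measurable]:
  "joint_density pinf p0 k n \<in> borel_measurable (obs_space n)"
proof (cases "n \<le> k")
  case True
  then have "joint_density pinf p0 k n = joint_density_inf pinf n"
    by (auto simp: joint_density_def joint_density_inf_def)
  then show ?thesis by (simp add: joint_density_inf_measurable)
next
  case False
  have "(\<lambda>x. (\<Prod>i=1..k. pinf i (restrict x {1..<i}) (x i)) *
           (\<Prod>i=k+1..n. p0 k i (restrict x {1..<i}) (x i))) \<in> borel_measurable (obs_space n)"
    using False unfolding obs_space_def
    by (intro borel_measurable_times borel_measurable_prod coord_measurable pinf_measurable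
        p0_measurable) auto
  then show ?thesis using False by (simp add: joint_density_def[abs_def])
qed

lemma joint_density_nonneg: "0 \<le> joint_density_inf pinf n x" "0 \<le> joint_density pinf p0 k n x"
  by (auto simp: joint_density_inf_def joint_density_def intro!: prod_nonneg mult_nonneg_nonneg
      pinf_nonneg p0_nonneg)

text \<open>The likelihood ratio as a function of the observed path instead of the sample point, so
  that integrals over it can be computed with the joint densities.\<close>

definition path_ratio :: "nat \<Rightarrow> nat \<Rightarrow> (nat \<Rightarrow> 's) \<Rightarrow> real" where
  "path_ratio k i x = p0 k i (restrict x {1..<i}) (x i) / pinf i (restrict x {1..<i}) (x i)"

lemma path_ratio_nonneg: "k < i \<Longrightarrow> 0 \<le> path_ratio k i x"
  by (auto simp: path_ratio_def intro!: divide_nonneg_nonneg pinf_nonneg p0_nonneg)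

lemma path_ratio_measurable: "k < i \<Longrightarrow> i \<le> n \<Longrightarrow> path_ratio k i \<in> borel_measurable (obs_space n)"
  unfolding path_ratio_def[abs_def] obs_space_def
  by (intro borel_measurable_divide coord_measurable pinf_measurable p0_measurable) auto

lemma LR_eq_path_ratio: "1 \<le> i \<Longrightarrow> i \<le> n \<Longrightarrow> LR k i \<omega> = path_ratio k i (obs n \<omega>)"
proof -
  assume i: "1 \<le> i" "i \<le> n"
  then have "restrict (obs n \<omega>) {1..<i} = history X i \<omega>"
    by (auto simp: history_def restrict_def obs_def)
  then show ?thesis using i by (simp add: lik_ratio_def path_ratio_def obs_def)
qed

lemma LR_nonneg: "k < i \<Longrightarrow> 0 \<le> LR k i \<omega>"
  using LR_eq_path_ratio[of i i] path_ratio_nonneg by simp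

text \<open>Where the no-change density is positive, none of its factors vanishes, so the
  denominators of the ratios after \<open>k\<close> cancel and no division by zero occurs.\<close>

lemma joint_density_eq:
  assumes "k < n" "0 < joint_density_inf pinf n x"
  shows "joint_density pinf p0 k n x = (\<Prod>i=k+1..n. path_ratio k i x) * joint_density_inf pinf n x"
proof -
  have nz: "pinf i (restrict x {1..<i}) (x i) \<noteq> 0" if "i \<in> {1..n}" for i
    using assms(2) that unfolding joint_density_inf_def
    by (metis finite_atLeastAtMost less_irrefl prod_zero_iff)
  have split: "{1..n} = {1..k} \<union> {k+1..n}" using assms(1) by auto
  have "joint_density_inf pinf n x
      = (\<Prod>i=1..k. pinf i (restrict x {1..<i}) (x i)) * (\<Prod>i=k+1..n. pinf i (restrict x {1..<i}) (x i))"
    unfolding joint_density_inf_def split by (rule prod.union_disjoint) auto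
  moreover have "(\<Prod>i=k+1..n. path_ratio k i x) * (\<Prod>i=k+1..n. pinf i (restrict x {1..<i}) (x i))
     = (\<Prod>i=k+1..n. p0 k i (restrict x {1..<i}) (x i))"
    unfolding prod.distrib[symmetric] path_ratio_def using nz by (intro prod.cong) auto
  ultimately show ?thesis using assms(1) by (simp add: joint_density_def mult_ac)
qed

section \<open>The observation filtration and measurability\<close>

lemma index_set_enat: "{i. 1 \<le> i \<and> enat i \<le> enat n} = {1..n}"
  by auto

lemma obs_measurable: "obs n \<in> measurable M (obs_space n)"
  unfolding obs_def[abs_def] obs_space_def
  using X_measurable by (intro measurable_restrict) auto

lemma F_eq: "F n = vimage_algebra (space M) (obs n) (obs_space n)"
  unfolding obs_filtration_def index_set_enat obs_def[abs_def] obs_space_def ..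

lemma sets_F: "sets (F n) = {obs n -` C \<inter> space M | C. C \<in> sets (obs_space n)}"
proof -
  have "obs n \<in> space M \<rightarrow> space (obs_space n)"
    using measurable_space[OF obs_measurable] by auto
  then show ?thesis
    unfolding F_eq by (rule sets_vimage_algebra2)
qed

lemma space_F [simp]: "space (F n) = space M"
  by (simp add: obs_filtration_def)

lemma obs_measurable_F: "obs n \<in> measurable (F n) (obs_space n)"
  unfolding F_eq
  by (intro measurable_vimage_algebra1) (use measurable_space[OF obs_measurable] in auto)

lemma sets_F_subset: "A \<in> sets (F n) \<Longrightarrow> A \<in> sets M"
  using measurable_sets[OF obs_measurable] by (auto simp: sets_F)

lemma subalgebra_F: "subalgebra Pinf (F n)" "subalgebra (P k) (F n)"
  using sets_F_subset by (auto simp: subalgebra_def space_eq sets_P sets_Pinf)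

lemma LR_measurable:
  assumes "k < i" "i \<le> n"
  shows "LR k i \<in> borel_measurable (F n)"
proof -
  have "LR k i = (\<lambda>\<omega>. path_ratio k i (obs n \<omega>))"
    using LR_eq_path_ratio[of i n k] assms by (auto simp: fun_eq_iff)
  then show ?thesis
    using measurable_compose[OF obs_measurable_F path_ratio_measurable[OF assms]] by simp
qed

lemma llr_measurable_F: "llr X pinf p0 k n \<in> borel_measurable (F (k + n))"
  unfolding llr_def[abs_def]
  by (intro borel_measurable_sum borel_measurable_ln LR_measurable) auto

lemma SR_stat_measurable: "i \<le> n \<Longrightarrow> SR_stat X pinf p0 i \<in> borel_measurable (F n)"
  unfolding SR_stat_def[abs_def]
  by (intro borel_measurable_sum borel_measurable_prod LR_measurable) auto

lemma density_obs:
  assumes "1 \<le> n"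
  shows "distributed Pinf (obs_space n) (obs n) (\<lambda>x. ennreal (joint_density_inf pinf n x))"
    and "distributed (P k) (obs_space n) (obs n) (\<lambda>x. ennreal (joint_density pinf p0 k n x))"
  using density_Pinf[OF assms] density_P[OF assms] unfolding obs_def[abs_def] obs_space_def by auto

lemma emeasure_Pinf_vimage:
  "1 \<le> n \<Longrightarrow> C \<in> sets (obs_space n) \<Longrightarrow>
   emeasure Pinf (obs n -` C \<inter> space M) = (\<integral>\<^sup>+x. ennreal (joint_density_inf pinf n x) * indicator C x
       \<partial>obs_space n)"
  using distributed_emeasure[OF density_obs(1)] by (simp add: space_eq)

lemma emeasure_P_vimage:
  "1 \<le> n \<Longrightarrow> C \<in> sets (obs_space n) \<Longrightarrow>
   emeasure (P k) (obs n -` C \<inter> space M) = (\<integral>\<^sup>+x. ennreal (joint_density pinf p0 k n x) * indicator C x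
       \<partial>obs_space n)"
  using distributed_emeasure[OF density_obs(2)] by (simp add: space_eq)

section \<open>Comparison of \<open>P k\<close> with \<open>Pinf\<close> on finite histories\<close>

lemma P_eq_Pinf:
  assumes "n \<le> k" "A \<in> sets (F n)" "1 \<le> n"
  shows "emeasure (P k) A = emeasure Pinf A"
proof -
  have "joint_density pinf p0 k n = joint_density_inf pinf n"
    using assms by (auto simp: joint_density_def joint_density_inf_def)
  then show ?thesis using assms by (auto simp: sets_F emeasure_Pinf_vimage emeasure_P_vimage)
qed

lemma null_Pinf_imp_null_P:
  assumes "1 \<le> n" "A \<in> sets (F n)" "emeasure Pinf A = 0"
  shows "emeasure (P k) A = 0"
proof -
  have "A \<in> null_sets (restr_to_subalg Pinf (F n))"
    using assms by (auto simp: null_sets_def emeasure_restr_to_subalg subalgebra_F sets_restr_to_subalg)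
  then have "A \<in> null_sets (restr_to_subalg (P k) (F n))"
    using ac_Pinf_P[OF assms(1)] by (auto simp: absolutely_continuous_def)
  then show ?thesis
    using assms by (auto simp: null_sets_def emeasure_restr_to_subalg subalgebra_F sets_restr_to_subalg)
qed

text \<open>A law does not charge the zero set of its own density. For the no-change density this
  gives a \<open>Pinf\<close>-null set, which absolute continuity makes null under
  \<open>P k\<close>.\<close>

lemma joint_density_zero_null:
  assumes "1 \<le> n"
  shows "emeasure (P k) (obs n -` {x\<in>space (obs_space n). joint_density_inf pinf n x = 0} \<inter> space M)
      = 0" (is ?inf)
    and "emeasure (P k) (obs n -` {x\<in>space (obs_space n). joint_density pinf p0 k n x = 0} \<inter> space M)
        = 0"
proof -
  have zero: "(\<integral>\<^sup>+x. ennreal (f x) * indicator {x\<in>space N. f x = 0} x \<partial>N) = 0"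
    for f and N :: "(nat \<Rightarrow> 's) measure"
    by (subst nn_integral_cong[where v="\<lambda>_. 0"]) (auto simp: indicator_def)
  show ?inf
  proof (rule null_Pinf_imp_null_P[OF assms])
    have C: "{x\<in>space (obs_space n). joint_density_inf pinf n x = 0} \<in> sets (obs_space n)" by measurable
    then show "obs n -` {x\<in>space (obs_space n). joint_density_inf pinf n x = 0} \<inter> space M \<in> sets (F n)"
      unfolding sets_F by blast
    show "emeasure Pinf (obs n -` {x\<in>space (obs_space n). joint_density_inf pinf n x = 0} \<inter> space M)
        = 0"
      using emeasure_Pinf_vimage[OF assms C] zero by simp
  qed
  have C: "{x\<in>space (obs_space n). joint_density pinf p0 k n x = 0} \<in> sets (obs_space n)" by measurable
  show "emeasure (P k) (obs n -` {x\<in>space (obs_space n). joint_density pinf p0 k n x = 0} \<inter> space M)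
      = 0"
    using emeasure_P_vimage[OF assms C] zero by simp
qed

lemma AE_joint_density_pos:
  assumes "1 \<le> n"
  shows "AE \<omega> in P k. 0 < joint_density_inf pinf n (obs n \<omega>) \<and> 0 < joint_density pinf p0 k n (obs n \<omega>)"
proof -
  have *: "AE \<omega> in P k. g (obs n \<omega>) \<noteq> 0"
    if g: "g \<in> borel_measurable (obs_space n)" and z:
        "emeasure (P k) (obs n -` {x\<in>space (obs_space n). g x = 0} \<inter> space M) = 0" for g :: "_ \<Rightarrow> real"
  proof (rule AE_I[OF _ z])
    show "{\<omega> \<in> space (P k). \<not> g (obs n \<omega>) \<noteq> 0} \<subseteq> obs n -` {x \<in> space (obs_space n). g x = 0} \<inter> space M"
      using measurable_space[OF obs_measurable, of _ n] by (auto simp: space_eq)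
    show "obs n -` {x \<in> space (obs_space n). g x = 0} \<inter> space M \<in> sets (P k)"
      unfolding sets_P using g by (intro measurable_sets[OF obs_measurable]) measurable
  qed
  from *[OF joint_density_inf_measurable joint_density_zero_null(1)[OF assms]]
    *[OF joint_density_measurable joint_density_zero_null(2)[OF assms]]
  show ?thesis
    by eventually_elim (auto simp: less_le joint_density_nonneg)
qed

text \<open>On paths where the ratio is at most \<open>c\<close>, the density of \<open>P k\<close>
  is at most \<open>c\<close> times that of \<open>Pinf\<close>. This moves events of alarm with a
  small likelihood ratio from \<open>P k\<close> to the no-change measure.\<close>

lemma P_le_mult_Pinf:
  assumes A: "A \<in> sets (F n)" and "k < n" and c: "0 \<le> c"
    and le: "AE \<omega> in P k. \<omega> \<in> A \<longrightarrow> (\<Prod>i=k+1..n. LR k i \<omega>) \<le> c"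
  shows "emeasure (P k) A \<le> ennreal c * emeasure Pinf A"
proof -
  obtain C where C: "C \<in> sets (obs_space n)" "A = obs n -` C \<inter> space M" using A by (auto simp: sets_F)
  have n: "1 \<le> n" using assms by simp
  \<comment> \<open>The bound on the ratio is known only almost surely on the sample space. Building
    it and the positivity of the density into \<open>C'\<close> makes both hold pointwise on paths,
    at the cost of a \<open>P k\<close>-null set.\<close>
  define C' where "C' = {x\<in>space (obs_space n). x \<in> C \<and> 0 < joint_density_inf pinf n x
      \<and> (\<Prod>i=k+1..n. path_ratio k i x) \<le> c}"
  have "(\<lambda>x. \<Prod>i=k+1..n. path_ratio k i x) \<in> borel_measurable (obs_space n)"
    by (intro borel_measurable_prod path_ratio_measurable) auto
  then have C': "C' \<in> sets (obs_space n)"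
    using C(1) unfolding C'_def by measurable
  have "emeasure (P k) A \<le> emeasure (P k) (obs n -` C' \<inter> space M)"
  proof (rule emeasure_mono_AE)
    show "obs n -` C' \<inter> space M \<in> sets (P k)"
      unfolding sets_P by (rule measurable_sets[OF obs_measurable C'])
    show "AE \<omega> in P k. \<omega> \<in> A \<longrightarrow> \<omega> \<in> obs n -` C' \<inter> space M"
      using le AE_joint_density_pos[OF n, of k]
    proof eventually_elim
      case (elim \<omega>)
      have "(\<Prod>i=k+1..n. LR k i \<omega>) = (\<Prod>i=k+1..n. path_ratio k i (obs n \<omega>))"
        by (intro prod.cong refl LR_eq_path_ratio) auto
      then show ?case
        using elim measurable_space[OF obs_measurable, of \<omega> n] by (auto simp: C'_def C(2))
    qed
  qed
  also have "\<dots> = (\<integral>\<^sup>+x. ennreal (joint_density pinf p0 k n x) * indicator C' x \<partial>obs_space n)"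
    by (rule emeasure_P_vimage[OF n C'])
  also have "\<dots> \<le> (\<integral>\<^sup>+x. ennreal c * (ennreal (joint_density_inf pinf n x) * indicator C x) \<partial>obs_space
      n)"
  proof (rule nn_integral_mono)
    fix x
    show "ennreal (joint_density pinf p0 k n x) * indicator C' x
      \<le> ennreal c * (ennreal (joint_density_inf pinf n x) * indicator C x)"
    proof (cases "x \<in> C'")
      case True
      then have x: "x \<in> C" "0 < joint_density_inf pinf n x" "(\<Prod>i=k+1..n. path_ratio k i x) \<le> c"
        by (auto simp: C'_def)
      then have "joint_density pinf p0 k n x \<le> c * joint_density_inf pinf n x"
        using joint_density_eq[OF assms(2) x(2)] by (simp add: mult_right_mono)
      then show ?thesis using True x c
        by (simp add: ennreal_mult'[symmetric] ennreal_leI)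
    qed simp
  qed
  also have "\<dots> = ennreal c * (\<integral>\<^sup>+x. (ennreal (joint_density_inf pinf n x) * indicator C x) \<partial>obs_space
      n)"
    using C(1) by (intro nn_integral_cmult borel_measurable_times_ennreal borel_measurable_indicator)
        measurable
  also have "\<dots> = ennreal c * emeasure Pinf A"
    using emeasure_Pinf_vimage[OF n C(1)] C(2) by simp
  finally show ?thesis .
qed

text \<open>Almost surely both joint densities are positive at the observed path, so no factor of
  their quotient vanishes. Countably many \<open>i\<close> share one null set.\<close>

lemma AE_LR_pos: "AE \<omega> in P k. \<forall>i>k. 0 < LR k i \<omega>"
proof -
  have "AE \<omega> in P k. 0 < LR k i \<omega>" if i: "k < i" for i
  proof -
    have "1 \<le> i" using i by simp
    from AE_joint_density_pos[OF this, of k] show ?thesis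
    proof eventually_elim
      case (elim \<omega>)
      then have "(\<Prod>j=k+1..i. path_ratio k j (obs i \<omega>)) \<noteq> 0"
        using joint_density_eq[OF i, of "obs i \<omega>"] by (metis less_irrefl mult_zero_left)
      then have "path_ratio k i (obs i \<omega>) \<noteq> 0" using i by auto
      then show ?case
        using i LR_nonneg[OF i, of \<omega>] LR_eq_path_ratio[of i i k \<omega>] by linarith
    qed
  qed
  then show ?thesis by (simp add: AE_all_countable)
qed

text \<open>The reverse change of measure, from \<open>Pinf\<close> to \<open>P k\<close>: the ratio
  times the no-change density is the density of \<open>P k\<close> where the no-change density is
  positive, and zero elsewhere.\<close>

lemma nn_integral_LR_le:
  assumes A: "A \<in> sets (F n)" and "k < n"
  shows "(\<integral>\<^sup>+\<omega>. ennreal (\<Prod>i=k+1..n. LR k i \<omega>) * indicator A \<omega> \<partial>Pinf) \<le> emeasure (P k) A"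
proof -
  obtain C where C: "C \<in> sets (obs_space n)" "A = obs n -` C \<inter> space M" using A by (auto simp: sets_F)
  have n: "1 \<le> n" using assms by simp
  have meas: "(\<lambda>x. ennreal (\<Prod>i=k+1..n. path_ratio k i x) * indicator C x)
      \<in> borel_measurable (obs_space n)"
    using C path_ratio_measurable[of k _ n]
      by (auto intro!: borel_measurable_times_ennreal measurable_compose[OF borel_measurable_prod
        measurable_ennreal])
  have "(\<integral>\<^sup>+\<omega>. ennreal (\<Prod>i=k+1..n. LR k i \<omega>) * indicator A \<omega> \<partial>Pinf)
     = (\<integral>\<^sup>+\<omega>. ennreal (\<Prod>i=k+1..n. path_ratio k i (obs n \<omega>)) * indicator C (obs n \<omega>) \<partial>Pinf)"
    using C(2) LR_eq_path_ratio[of _ n k]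
    by (intro nn_integral_cong) (auto simp: indicator_def space_eq intro!: arg_cong[of _ _ ennreal]
        prod.cong)
  also have "\<dots> = (\<integral>\<^sup>+x. ennreal (joint_density_inf pinf n x) * (ennreal (\<Prod>i=k+1..n. path_ratio k i x) *
      indicator C x) \<partial>obs_space n)"
    using distributed_nn_integral[OF density_obs(1)[OF n] meas] by simp
  also have "\<dots> \<le> (\<integral>\<^sup>+x. ennreal (joint_density pinf p0 k n x) * indicator C x \<partial>obs_space n)"
  proof (intro nn_integral_mono)
    fix x
    show "ennreal (joint_density_inf pinf n x) * (ennreal (\<Prod>i=k+1..n. path_ratio k i x) * indicator C x)
       \<le> ennreal (joint_density pinf p0 k n x) * indicator C x"
    proof (cases "joint_density_inf pinf n x = 0")
      case False
      then have "0 < joint_density_inf pinf n x" using joint_density_nonneg(1)[of n x] by linarith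
      from joint_density_eq[OF assms(2) this] show ?thesis
        using joint_density_nonneg(1)[of n x]
        by (subst mult.assoc[symmetric], subst ennreal_mult'[symmetric]) (auto simp: mult.commute)
    qed simp
  qed
  also have "\<dots> = emeasure (P k) A" using emeasure_P_vimage[OF n C(1)] C(2) by simp
  finally show ?thesis .
qed

subsection \<open>Distribution of the Shiryaev--Roberts time\<close>

text \<open>The infimum of a nonempty set of extended naturals is attained; only the empty set gives
  \<infinity>.\<close>

lemma SR_time_le_iff: "T B \<omega> \<le> enat n \<longleftrightarrow> (\<exists>i\<in>{1..n}. B \<le> R i \<omega>)"
proof
  let ?S = "{enat n |n. 1 \<le> n \<and> B \<le> R n \<omega>}"
  assume le: "T B \<omega> \<le> enat n"
  have "?S \<noteq> {}"
  proof
    assume "?S = {}"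
    then have "T B \<omega> = \<infinity>" by (simp only: SR_time_def) (simp add: Inf_enat_def)
    with le show False by simp
  qed
  then have "T B \<omega> \<in> ?S" unfolding SR_time_def Inf_enat_def
    by (metis (no_types, lifting) LeastI ex_in_conv)
  then show "\<exists>i\<in>{1..n}. B \<le> R i \<omega>" using le by auto
next
  assume "\<exists>i\<in>{1..n}. B \<le> R i \<omega>"
  then obtain i where i: "1 \<le> i" "i \<le> n" "B \<le> R i \<omega>" by auto
  then have "T B \<omega> \<le> enat i" unfolding SR_time_def by (intro Inf_lower) auto
  then show "T B \<omega> \<le> enat n" using i by (meson enat_ord_simps(1) order_trans)
qed

lemma SR_time_ge_1: "1 \<le> T B \<omega>"
  unfolding SR_time_def by (intro Inf_greatest) (auto simp: one_enat_def)

lemma SR_time_eq_imp: "T B \<omega> = enat n \<Longrightarrow> B \<le> R n \<omega>"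
proof -
  assume eq: "T B \<omega> = enat n"
  then obtain i where i: "i \<in> {1..n}" "B \<le> R i \<omega>" using SR_time_le_iff[of B \<omega> n] by auto
  then have "T B \<omega> \<le> enat i" using SR_time_le_iff[of B \<omega> i] by auto
  then show ?thesis using i eq by auto
qed

lemma SR_time_le_sets_F: "i \<le> n \<Longrightarrow> {\<omega>\<in>space M. T B \<omega> \<le> enat i} \<in> sets (F n)"
proof -
  assume i: "i \<le> n"
  have "(\<Union>j\<in>{1..i}. {\<omega>\<in>space (F n). B \<le> R j \<omega>}) \<in> sets (F n)"
  proof (intro sets.finite_UN)
    fix j assume "j \<in> {1..i}"
    then have [measurable]: "R j \<in> borel_measurable (F n)" using i by (intro SR_stat_measurable) auto
    show "{\<omega>\<in>space (F n). B \<le> R j \<omega>} \<in> sets (F n)" by measurable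
  qed simp
  moreover have "{\<omega>\<in>space M. T B \<omega> \<le> enat i} = (\<Union>j\<in>{1..i}. {\<omega>\<in>space (F n). B \<le> R j \<omega>})"
    by (auto simp: SR_time_le_iff)
  ultimately show ?thesis by simp
qed

lemma SR_time_eq_sets_F: "{\<omega>\<in>space M. T B \<omega> = enat n} \<in> sets (F n)"
proof -
  \<comment> \<open>The case \<open>n = 0\<close> is split off because \<open>n - 1\<close> is then
    again 0.\<close>
  have iff: "t = enat n \<longleftrightarrow> t \<le> enat n \<and> (n = 0 \<or> \<not> t \<le> enat (n - 1))" for t
    by (cases t) auto
  have "{\<omega>\<in>space M. T B \<omega> = enat n} = {\<omega>\<in>space M. T B \<omega> \<le> enat n} -
     (if n = 0 then {} else {\<omega>\<in>space M. T B \<omega> \<le> enat (n - 1)})"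
    unfolding iff by auto
  also have "\<dots> \<in> sets (F n)" by (auto intro!: sets.Diff SR_time_le_sets_F)
  finally show ?thesis .
qed

lemma SR_time_sets [measurable]:
  "{\<omega>\<in>space M. T B \<omega> \<le> enat n} \<in> sets M" "{\<omega>\<in>space M. T B \<omega> = enat n} \<in> sets M"
  "{\<omega>\<in>space M. enat n < T B \<omega>} \<in> sets M"
proof -
  show le: "{\<omega>\<in>space M. T B \<omega> \<le> enat n} \<in> sets M" and "{\<omega>\<in>space M. T B \<omega> = enat n} \<in> sets M"
    by (rule sets_F_subset[OF SR_time_le_sets_F[OF order_refl]] sets_F_subset[OF SR_time_eq_sets_F])+
  have "{\<omega>\<in>space M. enat n < T B \<omega>} = space M - {\<omega>\<in>space M. T B \<omega> \<le> enat n}" by auto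
  then show "{\<omega>\<in>space M. enat n < T B \<omega>} \<in> sets M" using le by auto
qed

lemma detection_procedure_SR_time: "detection_procedure M mu X (T B)"
  unfolding detection_procedure_def
proof (intro conjI ballI SR_time_ge_1)
  show "stopping_time (obs_filtration M mu X) (T B)"
  proof
    fix t :: enat
    show "Measurable.pred (obs_filtration M mu X t) (\<lambda>\<omega>. T B \<omega> \<le> t)"
      by (cases t) (use SR_time_le_sets_F[of _ _ B] in \<open>auto simp: pred_def\<close>)
  qed
qed

text \<open>Indexing by the change point instead of the first post-change observation makes summand
  \<open>k\<close> the likelihood ratio of \<open>P k\<close> against \<open>Pinf\<close>.\<close>

lemma SR_stat_eq: "R n \<omega> = (\<Sum>k<n. \<Prod>i=k+1..n. LR k i \<omega>)"
  unfolding SR_stat_def by (simp add: sum.atLeast1_atMost_eq)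

lemma prod_LR_le_SR_stat: "k < n \<Longrightarrow> (\<Prod>i=k+1..n. LR k i \<omega>) \<le> R n \<omega>"
  unfolding SR_stat_eq
  by (rule member_le_sum) (auto intro!: prod_nonneg LR_nonneg)

text \<open>Positivity keeps the conventional value of \<open>ln\<close> at zero out of the
  sum.\<close>

lemma exp_llr:
  assumes "\<forall>i>k. 0 < LR k i \<omega>"
  shows "exp (llr X pinf p0 k n \<omega>) = (\<Prod>i=k+1..k+n. LR k i \<omega>)"
  unfolding llr_def using assms by (subst exp_sum) (auto intro!: prod.cong)

section \<open>False alarm probabilities under no change\<close>

text \<open>Integrating \<open>R n\<close> over the event \<open>T B = n\<close> against
  \<open>Pinf\<close> turns each of its \<open>n\<close> summands into at most the
  \<open>P k\<close>-probability of that event. This takes the place of an optional stopping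
  argument.\<close>

lemma mult_Pinf_SR_time_eq_le:
  assumes "0 < B"
  shows "B * measure Pinf {\<omega>\<in>space M. T B \<omega> = enat n}
      \<le> (\<Sum>k<n. measure (P k) {\<omega>\<in>space M. T B \<omega> = enat n})"
proof -
  interpret Pinf: prob_space Pinf by (fact prob_space_Pinf)
  let ?A = "{\<omega>\<in>space M. T B \<omega> = enat n}"
  have A: "?A \<in> sets (F n)" by (rule SR_time_eq_sets_F)
  have AP: "?A \<in> sets Pinf" using sets_F_subset[OF A] sets_Pinf by simp
  have meas: "(\<lambda>\<omega>. ennreal (\<Prod>i=k+1..n. LR k i \<omega>) * indicator ?A \<omega>) \<in> borel_measurable Pinf" for k
  proof -
    have "(\<lambda>\<omega>. \<Prod>i=k+1..n. LR k i \<omega>) \<in> borel_measurable (F n)"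
      by (intro borel_measurable_prod LR_measurable) auto
    then have "(\<lambda>\<omega>. \<Prod>i=k+1..n. LR k i \<omega>) \<in> borel_measurable Pinf"
      by (rule measurable_from_subalg[OF subalgebra_F(1)])
    then show ?thesis using AP by measurable
  qed
  have "ennreal B * emeasure Pinf ?A = (\<integral>\<^sup>+\<omega>. ennreal B * indicator ?A \<omega> \<partial>Pinf)"
    using AP by (simp add: nn_integral_cmult_indicator)
  also have "\<dots> \<le> (\<integral>\<^sup>+\<omega>. (\<Sum>k<n. ennreal (\<Prod>i=k+1..n. LR k i \<omega>) * indicator ?A \<omega>) \<partial>Pinf)"
  proof (intro nn_integral_mono)
    fix \<omega>
    have "ennreal B \<le> (\<Sum>k<n. ennreal (\<Prod>i=k+1..n. LR k i \<omega>))" if "\<omega> \<in> ?A"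
    proof -
      have "ennreal B \<le> ennreal (R n \<omega>)" using that SR_time_eq_imp by (auto intro!: ennreal_leI)
      also have "\<dots> = (\<Sum>k<n. ennreal (\<Prod>i=k+1..n. LR k i \<omega>))"
        unfolding SR_stat_eq by (subst sum_ennreal) (auto intro!: prod_nonneg LR_nonneg)
      finally show ?thesis .
    qed
    then show "ennreal B * indicator ?A \<omega> \<le> (\<Sum>k<n. ennreal (\<Prod>i=k+1..n. LR k i \<omega>) * indicator ?A \<omega>)"
      by (cases "\<omega> \<in> ?A") simp_all
  qed
  also have "\<dots> = (\<Sum>k<n. \<integral>\<^sup>+\<omega>. ennreal (\<Prod>i=k+1..n. LR k i \<omega>) * indicator ?A \<omega> \<partial>Pinf)"
    by (rule nn_integral_sum) (rule meas)
  also have "\<dots> \<le> (\<Sum>k<n. emeasure (P k) ?A)"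
    by (intro sum_mono nn_integral_LR_le A) auto
  also have "\<dots> = ennreal (\<Sum>k<n. measure (P k) ?A)"
    by (simp add: sum_ennreal finite_measure.emeasure_eq_measure[OF prob_space.finite_measure[OF
        prob_space_P]])
  finally show ?thesis
    using assms by (simp add: Pinf.emeasure_eq_measure ennreal_mult'[symmetric] sum_nonneg)
qed

lemma sum_measure_SR_time_eq:
  assumes "finite J" "finite_measure Q" "sets Q = sets M"
  shows "(\<Sum>n\<in>J. measure Q {\<omega>\<in>space M. T B \<omega> = enat n}) = measure Q {\<omega>\<in>space M. \<exists>n\<in>J. T B \<omega> = enat n}"
proof -
  interpret Q: finite_measure Q by fact
  have "measure Q (\<Union>n\<in>J. {\<omega>\<in>space M. T B \<omega> = enat n}) = (\<Sum>n\<in>J. measure Q {\<omega>\<in>space M. T B \<omega> = enat n})"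
  proof (intro Q.finite_measure_finite_Union)
    show "(\<lambda>n. {\<omega>\<in>space M. T B \<omega> = enat n}) ` J \<subseteq> sets Q"
      unfolding assms(3) by (rule image_subsetI) (rule SR_time_sets)
  qed (use assms(1) in \<open>auto simp: disjoint_family_on_def\<close>)
  moreover have "(\<Union>n\<in>J. {\<omega>\<in>space M. T B \<omega> = enat n}) = {\<omega>\<in>space M. \<exists>n\<in>J. T B \<omega> = enat n}" by auto
  ultimately show ?thesis by simp
qed

lemma SR_time_le_iff_eq: "T B \<omega> \<le> enat K \<longleftrightarrow> (\<exists>n\<in>{1..K}. T B \<omega> = enat n)"
  using SR_time_ge_1[of B \<omega>] by (cases "T B \<omega>") (auto simp: one_enat_def)

lemma Pinf_SR_time_le:
  assumes "0 < B"
  shows "measure Pinf {\<omega>\<in>space M. T B \<omega> \<le> enat K} \<le> real K / B"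
proof -
  let ?E = "\<lambda>n. {\<omega>\<in>space M. T B \<omega> = enat n}"
  have fin: "finite_measure Pinf" "finite_measure (P k)" for k
    using prob_space_Pinf prob_space_P prob_space.finite_measure by blast+
  have "B * measure Pinf {\<omega>\<in>space M. T B \<omega> \<le> enat K} = (\<Sum>n=1..K. B * measure Pinf (?E n))"
    unfolding SR_time_le_iff_eq
    by (subst sum_measure_SR_time_eq[symmetric]) (auto simp: fin sets_Pinf sum_distrib_left)
  \<comment> \<open>Enlarging the inner range from \<open>k < n\<close> to \<open>k < K\<close>
    decouples the sums. After the swap, the events for a fixed \<open>k\<close> are disjoint and
    contribute at most 1.\<close>
  also have "\<dots> \<le> (\<Sum>n=1..K. \<Sum>k<K. measure (P k) (?E n))"
    by (intro sum_mono order_trans[OF mult_Pinf_SR_time_eq_le[OF assms]] sum_mono2) auto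
  also have "\<dots> = (\<Sum>k<K. \<Sum>n=1..K. measure (P k) (?E n))" by (rule sum.swap)
  also have "\<dots> \<le> (\<Sum>k<K. 1)"
    by (intro sum_mono, subst sum_measure_SR_time_eq) (auto simp: fin sets_P prob_space.prob_le_1[OF
        prob_space_P])
  finally show ?thesis using assms by (simp add: field_simps)
qed

section \<open>Tails of the detection delay under \<open>P k\<close>\<close>

text \<open>The statistic at time \<open>k + n\<close> is at least its \<open>k\<close>-th summand,
  almost surely the exponential of the log-likelihood ratio; without an alarm by then, that summand
  is below \<open>B\<close>.\<close>

lemma P_SR_time_gt_le:
  assumes "0 < B" "1 \<le> n"
  shows "measure (P k) {\<omega>\<in>space M. enat (k + n) < T B \<omega>}
      \<le> measure (P k) {\<omega>\<in>space M. llr X pinf p0 k n \<omega> < ln B}"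
proof -
  interpret prob_space "P k" by (fact prob_space_P)
  have [measurable]: "llr X pinf p0 k n \<in> borel_measurable (P k)"
    using measurable_from_subalg[OF subalgebra_F(2) llr_measurable_F] .
  have ev: "{\<omega>\<in>space M. llr X pinf p0 k n \<omega> < ln B} \<in> sets (P k)"
    unfolding space_eq(1)[symmetric, of k] by measurable
  show ?thesis
  proof (rule finite_measure_mono_AE[OF _ ev])
    show "AE \<omega> in P k. \<omega> \<in> {\<omega>\<in>space M. enat (k + n) < T B \<omega>} \<longrightarrow> \<omega>
        \<in> {\<omega>\<in>space M. llr X pinf p0 k n \<omega> < ln B}"
      using AE_LR_pos
    proof eventually_elim
      case (elim \<omega>)
      show ?case
      proof safe
        assume gt: "enat (k + n) < T B \<omega>"
        show "llr X pinf p0 k n \<omega> < ln B"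
        proof (rule ccontr)
          assume "\<not> llr X pinf p0 k n \<omega> < ln B"
          then have "exp (ln B) \<le> exp (llr X pinf p0 k n \<omega>)" by simp
          then have "B \<le> exp (llr X pinf p0 k n \<omega>)" using assms by simp
          also have "\<dots> \<le> R (k + n) \<omega>"
            unfolding exp_llr[OF elim] using assms by (intro prod_LR_le_SR_stat) auto
          finally have "T B \<omega> \<le> enat (k + n)" using assms by (auto simp: SR_time_le_iff)
          with gt show False by simp
        qed
      qed
    qed
  qed
qed

text \<open>The three terms bound an alarm by time \<open>k\<close>, when the law is still that of
  no change; an alarm later with the log-likelihood ratio below \<open>c\<close> at the alarm, by
  change of measure; and a maximum reaching \<open>c\<close>.\<close>

lemma P_SR_time_le:
  assumes B: "0 < B" and N: "1 \<le> N"
  shows "measure (P k) {\<omega>\<in>space M. T B \<omega> \<le> enat (k + N)} \<le>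
    real k / B + exp c * (real (k + N) / B) +
    measure (P k) {\<omega>\<in>space M. c \<le> (MAX n\<in>{1..N}. llr X pinf p0 k n \<omega>)}"
proof -
  interpret prob_space "P k" by (fact prob_space_P)
  let ?E = "\<lambda>n. {\<omega>\<in>space M. T B \<omega> = enat n}"
  let ?G = "\<lambda>n. {\<omega>\<in>space M. T B \<omega> = enat (k + n) \<and> llr X pinf p0 k n \<omega> < c}"
  let ?H = "{\<omega>\<in>space M. c \<le> (MAX n\<in>{1..N}. llr X pinf p0 k n \<omega>)}"
  have fin: "finite_measure Pinf" using prob_space_Pinf prob_space_P prob_space.finite_measure by blast
  have llr: "llr X pinf p0 k n \<in> borel_measurable (P k)" for n
    using measurable_from_subalg[OF subalgebra_F(2) llr_measurable_F] .
  have GF: "?G n \<in> sets (F (k + n))" for n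
  proof -
    have "?G n = ?E (k + n) \<inter> {\<omega>\<in>space (F (k + n)). llr X pinf p0 k n \<omega> < c}" by auto
    also have "\<dots> \<in> sets (F (k + n))"
      using llr_measurable_F by (intro sets.Int SR_time_eq_sets_F) measurable
    finally show ?thesis .
  qed
  have G: "?G n \<in> events" for n using sets_F_subset[OF GF] sets_P by simp
  have H: "?H \<in> events"
  proof -
    have "(\<lambda>\<omega>. MAX n\<in>{1..N}. llr X pinf p0 k n \<omega>) \<in> borel_measurable (P k)"
      using N by (intro borel_measurable_Max llr) auto
    then have "{\<omega>\<in>space (P k). c \<le> (MAX n\<in>{1..N}. llr X pinf p0 k n \<omega>)} \<in> events" by measurable
    then show ?thesis by (simp add: space_eq)
  qed
  have early: "prob {\<omega>\<in>space M. T B \<omega> \<le> enat k} \<le> real k / B"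
  \<comment> \<open>Equality of \<open>P k\<close> and \<open>Pinf\<close> is available only for
    nonempty histories; at \<open>k = 0\<close> the event is empty since the first possible alarm is
    at time 1.\<close>
  proof (cases "k = 0")
    case True
    have empty: "{\<omega>\<in>space M. T B \<omega> \<le> enat 0} = {}" by (auto simp: SR_time_le_iff)
    show ?thesis unfolding True empty by simp
  next
    case False
    then show ?thesis
      using P_eq_Pinf[of k k, OF _ SR_time_le_sets_F] Pinf_SR_time_le[OF B, of k]
        by (simp add: measure_def)
  qed
  have mid: "prob (?G n) \<le> exp c * measure Pinf (?E (k + n))" if n: "n \<in> {1..N}" for n
  proof -
    have "emeasure (P k) (?G n) \<le> ennreal (exp c) * emeasure Pinf (?G n)"
    proof (rule P_le_mult_Pinf[OF GF])
      show "AE \<omega> in P k. \<omega> \<in> ?G n \<longrightarrow> (\<Prod>i=k+1..k+n. LR k i \<omega>) \<le> exp c"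
        using AE_LR_pos
      proof eventually_elim
        case (elim \<omega>)
        show ?case unfolding exp_llr[OF elim, symmetric] by auto
      qed
    qed (use n in auto)
    also have "\<dots> \<le> ennreal (exp c) * emeasure Pinf (?E (k + n))"
      by (intro mult_left_mono emeasure_mono) (auto simp: sets_Pinf)
    finally show ?thesis
      by (simp add: emeasure_eq_measure finite_measure.emeasure_eq_measure[OF fin]
          ennreal_mult'[symmetric])
  qed
  have "{\<omega>\<in>space M. T B \<omega> \<le> enat (k + N)} \<subseteq> {\<omega>\<in>space M. T B \<omega> \<le> enat k} \<union> (\<Union>n\<in>{1..N}. ?G n) \<union> ?H"
  proof safe
    fix \<omega> assume \<omega>: "\<omega> \<in> space M" "T B \<omega> \<le> enat (k + N)" "\<not> c \<le> (MAX n\<in>{1..N}. llr X pinf p0 k n \<omega>)"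
      "\<omega> \<notin> (\<Union>n\<in>{1..N}. ?G n)"
    show "T B \<omega> \<le> enat k"
    proof (rule ccontr)
      assume "\<not> T B \<omega> \<le> enat k"
      with \<omega>(2) obtain n where n: "n \<in> {1..N}" "T B \<omega> = enat (k + n)"
        by (cases "T B \<omega>") (auto simp: not_le less_iff_Suc_add intro: that[of "_ - k"])
      have "llr X pinf p0 k n \<omega> \<le> (MAX n\<in>{1..N}. llr X pinf p0 k n \<omega>)"
        using n by (intro Max_ge) auto
      then have "llr X pinf p0 k n \<omega> < c" using \<omega>(3) by linarith
      then show False using n \<omega>(1,4) by auto
    qed
  qed
  then have "prob {\<omega>\<in>space M. T B \<omega> \<le> enat (k + N)}
      \<le> prob ({\<omega>\<in>space M. T B \<omega> \<le> enat k} \<union> (\<Union>n\<in>{1..N}. ?G n) \<union> ?H)"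
    using G H SR_time_sets(1) by (intro finite_measure_mono) (auto simp: sets_P)
  also have "\<dots> \<le> prob {\<omega>\<in>space M. T B \<omega> \<le> enat k} + prob (\<Union>n\<in>{1..N}. ?G n) + prob ?H"
    using G H SR_time_sets(1)
    by (intro order_trans[OF measure_Un_le] add_mono measure_Un_le order_refl) (auto simp: sets_P)
  also have "prob (\<Union>n\<in>{1..N}. ?G n) \<le> (\<Sum>n=1..N. prob (?G n))"
    using G by (intro finite_measure_subadditive_finite) auto
  also have "\<dots> \<le> (\<Sum>n=1..N. exp c * measure Pinf (?E (k + n)))"
    by (intro sum_mono mid)
  \<comment> \<open>Bounding each probability separately would lose a factor \<open>N\<close>; the
    shifted events are disjoint, so their sum is a single probability of an alarm by
    \<open>k + N\<close>.\<close>
  also have "\<dots> = exp c * (\<Sum>n\<in>(\<lambda>n. k + n) ` {1..N}. measure Pinf (?E n))"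
    by (subst sum.reindex) (auto simp: sum_distrib_left)
  also have "(\<Sum>n\<in>(\<lambda>n. k + n) ` {1..N}. measure Pinf (?E n))
      \<le> measure Pinf {\<omega>\<in>space M. T B \<omega> \<le> enat (k + N)}"
    using fin by (subst sum_measure_SR_time_eq) (auto simp: sets_Pinf intro!:
        finite_measure.finite_measure_mono)
  also have "\<dots> \<le> real (k + N) / B" by (rule Pinf_SR_time_le[OF B])
  finally show ?thesis using early by simp
qed

text \<open>From \<open>Suc N\<close> steps on, a missing alarm forces the log-likelihood ratio
  below \<open>ln B\<close>, hence below the line of slope \<open>a = I - \<epsilon>\<close>. Tail
  summation of the moment then produces \<open>Upsilon\<close> in a term free of
  \<open>B\<close>.\<close>

lemma delay_moment_le:
  fixes m r :: real
  assumes "0 < m" "m \<le> r" "1 \<le> r" "0 < B" and a: "a = I - \<epsilon>" "0 < a" and N: "ln B \<le> a * real (Suc N)"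
  shows "(\<integral>\<^sup>+\<omega>. enat_powr (T B \<omega> - enat k) m \<partial>P k) \<le>
    ennreal (real (Suc N) powr m) + ennreal (r * 2 powr (r - 1)) * Upsilon X pinf p0 P I k r \<epsilon>"
proof -
  interpret prob_space "P k" by (fact prob_space_P)
  define E where "E n = {\<omega>\<in>space M. N \<le> n \<and> enat (k + Suc n) < T B \<omega>}" for n
  let ?c = "\<lambda>n. ennreal (r * 2 powr (r - 1) * real (Suc n) powr (r - 1))"
  have E: "E n \<in> events" for n
    using SR_time_sets(3)[of "k + Suc n" B] by (cases "N \<le> n") (auto simp: E_def sets_P)
  \<comment> \<open>Truncated subtraction is harmless because a value above \<open>Suc n\<close> is
    positive.\<close>
  have iff: "enat (Suc n) < t - enat k \<longleftrightarrow> enat (k + Suc n) < t" for n t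
    by (cases t) auto
  have prob_le: "prob (E n) \<le> \<P>(\<omega> in P k. llr X pinf p0 k (Suc n) \<omega> / real (Suc n) < I - \<epsilon>)" for n
  proof (cases "N \<le> n")
    case True
    have [measurable]: "llr X pinf p0 k (Suc n) \<in> borel_measurable (P k)"
      using measurable_from_subalg[OF subalgebra_F(2) llr_measurable_F] .
    have ev: "{\<omega>\<in>space M. llr X pinf p0 k (Suc n) \<omega> < a * real (Suc n)} \<in> events"
      unfolding space_eq(1)[symmetric, of k] by measurable
    have "a * real (Suc N) \<le> a * real (Suc n)" using True a by simp
    then have lnB: "ln B \<le> a * real (Suc n)" using N by linarith
    have "prob (E n) \<le> prob {\<omega>\<in>space M. llr X pinf p0 k (Suc n) \<omega> < ln B}"
      using P_SR_time_gt_le[of B "Suc n" k] True assms by (simp add: E_def)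
    also have "\<dots> \<le> \<P>(\<omega> in P k. llr X pinf p0 k (Suc n) \<omega> / real (Suc n) < I - \<epsilon>)"
      using lnB ev by (intro finite_measure_mono) (auto simp: space_eq a(1)[symmetric] divide_less_eq
          simp del: of_nat_Suc)
    finally show ?thesis .
  qed (simp add: E_def)
  have "(\<integral>\<^sup>+\<omega>. enat_powr (T B \<omega> - enat k) m \<partial>P k) \<le>
     (\<integral>\<^sup>+\<omega>. ennreal (real (Suc N) powr m) + (\<Sum>n. ?c n * indicator (E n) \<omega>) \<partial>P k)"
  proof (rule nn_integral_mono)
    fix \<omega> assume "\<omega> \<in> space (P k)"
    then have "indicator {n. N \<le> n \<and> enat (Suc n) < T B \<omega> - enat k} n = (indicator (E n) \<omega> :: ennreal)"
      for n
      unfolding iff by (simp add: E_def indicator_def space_eq)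
    then show "enat_powr (T B \<omega> - enat k) m \<le> ennreal (real (Suc N) powr m)
        + (\<Sum>n. ?c n * indicator (E n) \<omega>)"
      using enat_powr_le_tail_sum[OF assms(1-3), of "T B \<omega> - enat k" N] by simp
  qed
  also have "\<dots> = ennreal (real (Suc N) powr m) + (\<Sum>n. ?c n * emeasure (P k) (E n))"
    using E by (subst nn_integral_add) (auto simp: emeasure_space_1 nn_integral_suminf
        nn_integral_cmult_indicator)
  also have "(\<Sum>n. ?c n * emeasure (P k) (E n)) \<le>
     (\<Sum>n. ennreal (r * 2 powr (r - 1)) * ennreal (real (Suc n) powr (r - 1) *
        \<P>(\<omega> in P k. llr X pinf p0 k (Suc n) \<omega> / real (Suc n) < I - \<epsilon>)))"
  proof (intro suminf_le)
    fix n
    have "r * 2 powr (r - 1) * real (Suc n) powr (r - 1) * prob (E n)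
        \<le> r * 2 powr (r - 1) * (real (Suc n) powr (r - 1) *
        \<P>(\<omega> in P k. llr X pinf p0 k (Suc n) \<omega> / real (Suc n) < I - \<epsilon>))"
      unfolding mult.assoc using prob_le[of n] assms by (intro mult_left_mono) auto
    then show "?c n * emeasure (P k) (E n)
        \<le> ennreal (r * 2 powr (r - 1)) * ennreal (real (Suc n) powr (r - 1) *
        \<P>(\<omega> in P k. llr X pinf p0 k (Suc n) \<omega> / real (Suc n) < I - \<epsilon>))"
      using assms by (simp add: emeasure_eq_measure ennreal_mult'[symmetric] ennreal_leI)
  qed auto
  also have "\<dots> = ennreal (r * 2 powr (r - 1)) * Upsilon X pinf p0 P I k r \<epsilon>"
    unfolding Upsilon_def by (rule ennreal_suminf_cmult)
  finally show ?thesis by (simp add: add_left_mono)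
qed

subsection \<open>Asymptotics of the delay moments\<close>

text \<open>With \<theta> below 1, a delay of \<theta> times the expected \<open>ln B / I\<close> is
  too short for the log-likelihood ratio to reach \<open>ln B\<close>. All three terms of the
  early-alarm bound vanish as \<open>B\<close> grows.\<close>

lemma P_SR_time_gt_tendsto:
  fixes I \<theta> :: real
  assumes \<theta>: "0 < \<theta>" "\<theta> < 1" and I: "0 < I"
    and upper: "\<And>\<epsilon>. 0 < \<epsilon> \<Longrightarrow>
      (\<lambda>N. \<P>(\<omega> in P k. (1 + \<epsilon>) * I \<le> (MAX n\<in>{1..N}. llr X pinf p0 k n \<omega>) / real N)) \<longlonglongrightarrow> 0"
  shows "((\<lambda>B. measure (P k) {\<omega>\<in>space M. enat (k + nat \<lfloor>\<theta> * ln B / I\<rfloor>) < T B \<omega>}) \<longlongrightarrow> 1) at_top"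
proof -
  interpret prob_space "P k" by (fact prob_space_P)
  define N where "N B = nat \<lfloor>\<theta> * ln B / I\<rfloor>" for B
  \<comment> \<open>Chosen so that \<open>(1 + \<epsilon>) * \<theta>\<close> is the midpoint of
    \<theta> and 1, which is \<open>1 - \<delta>\<close>. The change-of-measure factor is then at
    most \<open>B powr (1 - \<delta>)\<close>, and division by \<open>B\<close> leaves a negative
    power that beats the logarithm.\<close>
  define \<epsilon> where "\<epsilon> = (1 - \<theta>) / (2 * \<theta>)"
  define \<delta> where "\<delta> = (1 - \<theta>) / 2"
  define h where "h n = \<P>(\<omega> in P k. (1 + \<epsilon>) * I \<le> (MAX n\<in>{1..n}. llr X pinf p0 k n \<omega>) / real n)" for n
  have pos: "0 < \<epsilon>" "0 < \<delta>" using \<theta> by (auto simp: \<epsilon>_def \<delta>_def)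
  have eps: "(1 + \<epsilon>) * \<theta> = 1 - \<delta>" using \<theta> by (simp add: \<epsilon>_def \<delta>_def field_simps)
  have N_lim: "filterlim N at_top at_top"
  proof -
    have "filterlim (\<lambda>B. \<theta> * ln B / I) at_top at_top" using \<theta> I by real_asymp
    then show ?thesis unfolding N_def
      by (rule filterlim_compose[OF filterlim_nat_sequentially filterlim_compose[OF
          filterlim_floor_sequentially]])
  qed
  have h_lim: "((\<lambda>B. h (N B)) \<longlongrightarrow> 0) at_top"
    using filterlim_compose[OF upper[OF pos(1)] N_lim] by (simp add: h_def)
  have bound_lim: "((\<lambda>B. real k / B + B powr (-\<delta>) * (real k + \<theta> * ln B / I) + h (N B)) \<longlongrightarrow> 0 + 0) at_top"
  proof (intro tendsto_add h_lim)
    have "((\<lambda>B. real k * (1 / B) + (real k * B powr (-\<delta>) + \<theta> / I * (B powr (-\<delta>) * ln B))) \<longlongrightarrow>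
        real k * 0 + (real k * 0 + \<theta> / I * 0)) at_top"
      by (intro tendsto_add tendsto_mult tendsto_const) (use pos in real_asymp)+
    then show "((\<lambda>B. real k / B + B powr (-\<delta>) * (real k + \<theta> * ln B / I)) \<longlongrightarrow> 0) at_top"
      by (simp add: algebra_simps)
  qed
  have bound: "\<forall>\<^sub>F B in at_top. prob {\<omega>\<in>space M. T B \<omega> \<le> enat (k + N B)} \<le>
      real k / B + B powr (-\<delta>) * (real k + \<theta> * ln B / I) + h (N B)"
    using eventually_gt_at_top[of 1] filterlim_at_top[THEN iffD1, OF N_lim, rule_format, of 1]
  proof eventually_elim
    case (elim B)
    let ?c = "(1 + \<epsilon>) * I * real (N B)"
    have NB: "real (N B) \<le> \<theta> * ln B / I"
      using elim \<theta> I by (simp add: N_def)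
    then have "?c \<le> (1 + \<epsilon>) * I * (\<theta> * ln B / I)" using I pos by (intro mult_left_mono) auto
    also have "\<dots> = (1 - \<delta>) * ln B" using I by (simp add: eps[symmetric])
    finally have "exp ?c \<le> exp ((1 - \<delta>) * ln B)" by simp
    also have "\<dots> = B powr (-\<delta>) * B" using elim
      by (simp add: powr_def algebra_simps exp_diff exp_minus divide_inverse)
    finally have "exp ?c * (real (k + N B) / B) \<le> (B powr (-\<delta>) * B) * ((real k + \<theta> * ln B / I) / B)"
      using elim NB by (intro mult_mono divide_right_mono) auto
    also have "\<dots> = B powr (-\<delta>) * (real k + \<theta> * ln B / I)" using elim by simp
    finally have mid: "exp ?c * (real (k + N B) / B) \<le> B powr (-\<delta>) * (real k + \<theta> * ln B / I)" .
    have "{\<omega>\<in>space M. ?c \<le> (MAX n\<in>{1..N B}. llr X pinf p0 k n \<omega>)} =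
      {\<omega>\<in>space (P k). (1 + \<epsilon>) * I \<le> (MAX n\<in>{1..N B}. llr X pinf p0 k n \<omega>) / real (N B)}"
      using elim by (auto simp: space_eq le_divide_eq)
    then have "prob {\<omega>\<in>space M. ?c \<le> (MAX n\<in>{1..N B}. llr X pinf p0 k n \<omega>)} = h (N B)"
      by (simp add: h_def)
    then show ?case using P_SR_time_le[of B "N B" k ?c] elim mid by simp
  qed
  have "((\<lambda>B. prob {\<omega>\<in>space M. T B \<omega> \<le> enat (k + N B)}) \<longlongrightarrow> 0) at_top"
    by (rule tendsto_sandwich[OF _ bound tendsto_const]) (use bound_lim in auto)
  then have "((\<lambda>B. 1 - prob {\<omega>\<in>space M. T B \<omega> \<le> enat (k + N B)}) \<longlongrightarrow> 1 - 0) at_top"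
    by (intro tendsto_diff tendsto_const)
  moreover have "1 - prob {\<omega>\<in>space M. T B \<omega> \<le> enat j} = prob {\<omega>\<in>space M. enat j < T B \<omega>}" for B j
  proof -
    have "{\<omega>\<in>space M. enat j < T B \<omega>} = space (P k) - {\<omega>\<in>space M. T B \<omega> \<le> enat j}"
      by (auto simp: space_eq)
    then show ?thesis using prob_compl[of "{\<omega>\<in>space M. T B \<omega> \<le> enat j}"] SR_time_sets(1)[of B j]
      by (simp add: sets_P)
  qed
  ultimately show ?thesis by (simp add: N_def)
qed

text \<open>Markov's inequality, in a form that allows an infinite delay.\<close>

lemma delay_moment_ge:
  assumes "0 < m"
  shows "ennreal (real N powr m * measure (P k) {\<omega>\<in>space M. enat (k + N) < T B \<omega>})
    \<le> (\<integral>\<^sup>+\<omega>. enat_powr (T B \<omega> - enat k) m \<partial>P k)"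
proof -
  interpret prob_space "P k" by (fact prob_space_P)
  let ?A = "{\<omega>\<in>space M. enat (k + N) < T B \<omega>}"
  have A: "?A \<in> events" using SR_time_sets(3) sets_P by simp
  have iff: "enat N < t - enat k \<longleftrightarrow> enat (k + N) < t" for t
    by (cases t) auto
  have "ennreal (real N powr m * prob ?A) = (\<integral>\<^sup>+\<omega>. ennreal (real N powr m) * indicator ?A \<omega> \<partial>P k)"
    using A by (simp add: nn_integral_cmult_indicator emeasure_eq_measure ennreal_mult')
  also have "\<dots> \<le> (\<integral>\<^sup>+\<omega>. enat_powr (T B \<omega> - enat k) m \<partial>P k)"
    using assms by (intro nn_integral_mono) (auto simp: indicator_def iff intro!: enat_powr_ge)
  finally show ?thesis .
qed

text \<open>The numerator of the conditional moment, whose growth is studied apart from the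
  normalization.\<close>

definition delay_sum :: "int pmf \<Rightarrow> real \<Rightarrow> real \<Rightarrow> ennreal" where
  "delay_sum prior m B = (\<Sum>k. ennreal (prior_at prior k) * (\<integral>\<^sup>+\<omega>. enat_powr (T B \<omega> - enat k) m \<partial>P k))"

text \<open>One index \<open>j\<close> governs all approximations: the slope factor
  \<open>\<theta> j\<close> in both bounds, and the truncation of the prior in the lower one. For
  fixed \<open>j\<close> the limit in \<open>B\<close> is elementary; then \<open>j\<close> tends to
  infinity.\<close>

lemma delay_sum_tendsto:
  fixes I r m :: real
  assumes I: "0 < I" and r: "1 \<le> r" and m: "0 < m" "m \<le> r"
    and llr_upper: "\<And>\<epsilon> k. 0 < \<epsilon> \<Longrightarrow>
          (\<lambda>N. \<P>(\<omega> in P k. (1 + \<epsilon>) * I \<le> (MAX n\<in>{1..N}. llr X pinf p0 k n \<omega>) / real N)) \<longlonglongrightarrow> 0"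
    and llr_lower: "\<And>\<epsilon>. 0 < \<epsilon> \<Longrightarrow> (\<Sum>k. ennreal (prior_at prior k) * Upsilon X pinf p0 P I k r \<epsilon>) < \<infinity>"
  shows "((\<lambda>B. delay_sum prior m B / ennreal (ln B powr m))
      \<longlongrightarrow> ennreal ((\<Sum>k. prior_at prior k) / I powr m)) at_top"
proof -
  let ?S = "\<Sum>k. prior_at prior k"
  have S: "0 \<le> ?S" by (simp add: suminf_nonneg summable_prior)
  \<comment> \<open>The shift by 2 keeps the value strictly between 0 and 1 already at
    \<open>j = 0\<close>.\<close>
  define \<theta> where "\<theta> j = 1 - 1 / real (j + 2)" for j :: nat
  have \<theta>: "0 < \<theta> j" "\<theta> j < 1" for j by (auto simp: \<theta>_def field_simps)
  have \<theta>_lim: "\<theta> \<longlonglongrightarrow> 1" unfolding \<theta>_def by real_asymp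
  define a where "a j = \<theta> j * I" for j
  have a: "0 < a j" "a j < I" for j using \<theta> I by (auto simp: a_def)
  define N where "N j B = nat \<lfloor>\<theta> j * ln B / I\<rfloor>" for j B
  define N' where "N' j B = nat \<lfloor>ln B / a j\<rfloor>" for j B
  define p where "p j k B = measure (P k) {\<omega>\<in>space M. enat (k + N j B) < T B \<omega>}" for j k B
  define C where "C = r * 2 powr (r - 1)"
  define Y where "Y j = enn2real (\<Sum>k. ennreal (prior_at prior k) * Upsilon X pinf p0 P I k r (I - a
      j))" for j
  have C: "0 \<le> C" using r by (simp add: C_def)
  have Y: "(\<Sum>k. ennreal (prior_at prior k) * Upsilon X pinf p0 P I k r (I - a j)) = ennreal (Y j)" "0
      \<le> Y j" for j
    using llr_lower[of "I - a j"] a[of j] by (auto simp: Y_def)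
  \<comment> \<open>Convergence of \<open>p\<close> to 1 is not uniform in \<open>k\<close>; over
    finitely many \<open>k\<close> the limit may be taken termwise.\<close>
  define lo where "lo j B = (\<Sum>k<j. prior_at prior k * (real (N j B) / ln B) powr m * p j k B)" for j B
  \<comment> \<open>The moment bounds are summed over all \<open>k\<close>: the leading term is the
    same for every \<open>k\<close>, and the remainder is finite by the assumption on
    \<open>Upsilon\<close> with \<open>\<epsilon> = I - a j\<close>. Division by the power of
    \<open>ln B\<close> removes it.\<close>
  define hi where "hi j B = ?S * (real (Suc (N' j B)) / ln B) powr m + C * Y j / ln B powr m" for j B
  show ?thesis
  proof (rule tendsto_bound_families)
    fix j
    show "\<forall>\<^sub>F B in at_top. ennreal (lo j B) \<le> delay_sum prior m B / ennreal (ln B powr m)"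
      using eventually_gt_at_top[of 1]
    proof eventually_elim
      case (elim B)
      have "lo j B * ln B powr m = (\<Sum>k<j. prior_at prior k * (real (N j B) powr m * p j k B))"
        unfolding lo_def sum_distrib_right using elim by (intro sum.cong) (auto simp: powr_divide)
      then have "ennreal (lo j B * ln B powr m)
          = (\<Sum>k<j. ennreal (prior_at prior k) * ennreal (real (N j B) powr m * p j k B))"
        by (simp add: sum_ennreal[symmetric] p_def ennreal_mult')
      also have "\<dots> \<le> (\<Sum>k<j. ennreal (prior_at prior k) * (\<integral>\<^sup>+\<omega>. enat_powr (T B \<omega> - enat k) m \<partial>P k))"
        unfolding p_def by (intro sum_mono mult_left_mono delay_moment_ge m) auto
      also have "\<dots> \<le> delay_sum prior m B"
        unfolding delay_sum_def by (intro sum_le_suminf) auto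
      finally have "ennreal (lo j B * ln B powr m) / ennreal (ln B powr m)
          \<le> delay_sum prior m B / ennreal (ln B powr m)"
        by (rule divide_right_mono_ennreal)
      moreover have "0 \<le> lo j B" by (auto simp: lo_def p_def intro!: sum_nonneg)
      ultimately show ?case using elim by (simp add: divide_ennreal)
    qed
    have "((\<lambda>B. real (N j B) / ln B) \<longlongrightarrow> \<theta> j * inverse I) at_top"
      unfolding N_def using \<theta>[of j] I by real_asymp
    then have "((\<lambda>B. real (N j B) / ln B) \<longlongrightarrow> \<theta> j / I) at_top"
      by (simp add: divide_inverse)
    then show "((\<lambda>B. ennreal (lo j B))
        \<longlongrightarrow> ennreal (\<Sum>k<j. prior_at prior k * (\<theta> j / I) powr m * 1)) at_top"
      unfolding lo_def p_def N_def using \<theta>[of j] I llr_upper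
      by (intro tendsto_ennrealI tendsto_sum tendsto_mult tendsto_const tendsto_powr
          P_SR_time_gt_tendsto) auto
  next
    have "(\<lambda>j. ennreal ((\<Sum>k<j. prior_at prior k) * (\<theta> j / I) powr m)) \<longlonglongrightarrow> ennreal (?S * (1 / I) powr m)"
      using I by (intro tendsto_ennrealI tendsto_mult summable_LIMSEQ summable_prior tendsto_powr
          tendsto_divide \<theta>_lim tendsto_const) auto
    then show "(\<lambda>j. ennreal (\<Sum>k<j. prior_at prior k * (\<theta> j / I) powr m * 1)) \<longlonglongrightarrow> ennreal (?S / I powr m)"
      using I by (simp add: sum_distrib_right sum_divide_distrib powr_divide)
  next
    fix j
    show "\<forall>\<^sub>F B in at_top. delay_sum prior m B / ennreal (ln B powr m) \<le> ennreal (hi j B)"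
      using eventually_gt_at_top[of 1]
    proof eventually_elim
      case (elim B)
      \<comment> \<open>The successor makes up for rounding down.\<close>
      have "ln B / a j \<le> real (Suc (N' j B))"
        using elim a(1)[of j] unfolding N'_def by simp linarith
      then have N': "ln B \<le> a j * real (Suc (N' j B))" using a(1)[of j]
        by (simp add: divide_le_eq mult.commute)
      have "delay_sum prior m B
          \<le> (\<Sum>k. ennreal (prior_at prior k) * (ennreal (real (Suc (N' j B)) powr m) +
          ennreal C * Upsilon X pinf p0 P I k r (I - a j)))"
        unfolding delay_sum_def C_def using m r elim a N'
        by (intro suminf_le mult_left_mono delay_moment_le[where a="a j"]) auto
      also have "\<dots> = (\<Sum>k. ennreal (real (Suc (N' j B)) powr m) * ennreal (prior_at prior k) +
          ennreal C * (ennreal (prior_at prior k) * Upsilon X pinf p0 P I k r (I - a j)))"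
        by (intro suminf_cong) (simp add: distrib_left mult_ac)
      also have "\<dots> = (\<Sum>k. ennreal (real (Suc (N' j B)) powr m) * ennreal (prior_at prior k)) +
         (\<Sum>k. ennreal C * (ennreal (prior_at prior k) * Upsilon X pinf p0 P I k r (I - a j)))"
        by (intro suminf_add[symmetric]) auto
      also have "\<dots> = ennreal (real (Suc (N' j B)) powr m) * ennreal ?S + ennreal C * ennreal (Y j)"
        by (simp add: suminf_ennreal2 summable_prior Y)
      also have "\<dots> = ennreal (real (Suc (N' j B)) powr m * ?S + C * Y j)"
        using S C Y(2) by (simp add: ennreal_mult' ennreal_plus)
      finally have "delay_sum prior m B / ennreal (ln B powr m)
          \<le> ennreal (real (Suc (N' j B)) powr m * ?S + C * Y j) / ennreal (ln B powr m)"
        by (rule divide_right_mono_ennreal)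
      also have "\<dots> = ennreal (hi j B)"
        using elim S C Y(2) by (subst divide_ennreal) (auto simp: hi_def powr_divide add_divide_distrib
            mult.commute simp del: of_nat_Suc)
      finally show ?case .
    qed
    have "((\<lambda>B. real (Suc (N' j B)) / ln B) \<longlongrightarrow> inverse (a j)) at_top"
      unfolding N'_def using a[of j] by real_asymp
    then have "((\<lambda>B. real (Suc (N' j B)) / ln B) \<longlongrightarrow> 1 / a j) at_top"
      by (simp add: inverse_eq_divide)
    moreover have "((\<lambda>B. C * Y j / ln B powr m) \<longlongrightarrow> 0) at_top"
      using m by real_asymp
    ultimately show "((\<lambda>B. ennreal (hi j B)) \<longlongrightarrow> ennreal (?S * (1 / a j) powr m + 0)) at_top"
      unfolding hi_def using a[of j]
      by (intro tendsto_ennrealI tendsto_add tendsto_mult tendsto_const tendsto_powr) auto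
  next
    have "(\<lambda>j. ennreal (?S * (1 / (\<theta> j * I)) powr m + 0)) \<longlonglongrightarrow> ennreal (?S * (1 / (1 * I)) powr m + 0)"
      using I by (intro tendsto_ennrealI tendsto_add tendsto_mult tendsto_powr tendsto_divide \<theta>_lim
          tendsto_const) auto
    then show "(\<lambda>j. ennreal (?S * (1 / a j) powr m + 0)) \<longlonglongrightarrow> ennreal (?S / I powr m)"
      using I by (simp add: a_def powr_divide)
  qed
qed

section \<open>Normalization and conditional moments\<close>

text \<open>The alarm bound \<open>real k / B\<close>, weighted by the prior, leaves a deficit of at
  most \<open>prior_mean prior / B\<close>; this is where the finite mean enters.\<close>

lemma weighted_no_alarm_tendsto:
  assumes "summable (\<lambda>j. real (Suc j) * prior_at prior (Suc j))"
  shows "((\<lambda>B. \<Sum>k. prior_at prior k * \<P>(\<omega> in Pinf. enat k < T B \<omega>)) \<longlongrightarrow> (\<Sum>k. prior_at prior k)) at_top"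
proof -
  interpret prob_space Pinf by (fact prob_space_Pinf)
  let ?g = "\<lambda>B. \<Sum>k. prior_at prior k * \<P>(\<omega> in Pinf. enat k < T B \<omega>)"
  note mean = prior_mean_altdef[OF assms]
  have sm: "summable (\<lambda>k. prior_at prior k * \<P>(\<omega> in Pinf. enat k < T B \<omega>))" for B
    by (rule summable_comparison_test'[OF summable_prior]) (auto intro!: mult_left_le)
  have upper: "?g B \<le> (\<Sum>k. prior_at prior k)" for B
    by (intro suminf_le sm summable_prior) (auto intro!: mult_left_le)
  have lower: "\<forall>\<^sub>F B in at_top. (\<Sum>k. prior_at prior k) - prior_mean prior / B \<le> ?g B"
    using eventually_gt_at_top[of 0]
  proof eventually_elim
    case (elim B)
    have ge: "1 - real k / B \<le> \<P>(\<omega> in Pinf. enat k < T B \<omega>)" for k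
    proof -
      have "{\<omega>\<in>space Pinf. enat k < T B \<omega>} = space Pinf - {\<omega>\<in>space M. T B \<omega> \<le> enat k}"
        by (auto simp: space_eq)
      then have "\<P>(\<omega> in Pinf. enat k < T B \<omega>) = 1 - prob {\<omega>\<in>space M. T B \<omega> \<le> enat k}"
        using prob_compl[of "{\<omega>\<in>space M. T B \<omega> \<le> enat k}"] SR_time_sets(1)[of B k]
          by (simp add: sets_Pinf)
      then show ?thesis using Pinf_SR_time_le[OF elim, of k] by simp
    qed
    have sums: "(\<lambda>k. prior_at prior k - prior_at prior k * real k / B) sums ((\<Sum>k. prior_at prior k) -
        prior_mean prior / B)"
      by (intro sums_diff sums_divide mean summable_sums summable_prior)
    have "prior_at prior k - prior_at prior k * real k / B
        \<le> prior_at prior k * \<P>(\<omega> in Pinf. enat k < T B \<omega>)" for k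
      using mult_left_mono[OF ge[of k], of "prior_at prior k"] by (simp add: algebra_simps)
    then have "(\<Sum>k. prior_at prior k - prior_at prior k * real k / B) \<le> ?g B"
      using sums sm by (intro suminf_le) (auto simp: sums_iff)
    then show ?case using sums by (simp add: sums_iff)
  qed
  have "((\<lambda>B. (\<Sum>k. prior_at prior k) - prior_mean prior / B) \<longlongrightarrow> (\<Sum>k. prior_at prior k) - 0) at_top"
    by (intro tendsto_diff tendsto_const tendsto_divide_0[OF tendsto_const]
        filterlim_at_top_imp_at_infinity filterlim_ident)
  then show ?thesis
    using tendsto_sandwich[OF lower always_eventually[OF allI[OF upper]] _ tendsto_const] by simp
qed

text \<open>Numerator and normalization both carry the prior mass of the nonnegative integers in the
  limit. It is positive as \<open>q < 1\<close>, and it cancels.\<close>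

lemma cond_delay_moment_tendsto:
  fixes I r m :: real
  assumes q: "measure_pmf.prob prior {..<0} < 1"
    and mean: "summable (\<lambda>j. real (Suc j) * prior_at prior (Suc j))"
    and I: "0 < I" and r: "1 \<le> r" and m: "0 < m" "m \<le> r"
    and llr_upper: "\<And>\<epsilon> k. 0 < \<epsilon> \<Longrightarrow>
          (\<lambda>N. \<P>(\<omega> in P k. (1 + \<epsilon>) * I \<le> (MAX n\<in>{1..N}. llr X pinf p0 k n \<omega>) / real N)) \<longlonglongrightarrow> 0"
    and llr_lower: "\<And>\<epsilon>. 0 < \<epsilon> \<Longrightarrow> (\<Sum>k. ennreal (prior_at prior k) * Upsilon X pinf p0 P I k r \<epsilon>) < \<infinity>"
  shows "((\<lambda>B. cond_delay_moment Pinf P prior (T B) m / ennreal (ln B powr m))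
      \<longlongrightarrow> ennreal (1 / I powr m)) at_top"
proof -
  let ?S = "\<Sum>k. prior_at prior k"
  let ?g = "\<lambda>B. \<Sum>k. prior_at prior k * \<P>(\<omega> in Pinf. enat k < T B \<omega>)"
  have S: "0 < ?S" by (rule suminf_prior_pos[OF q])
  note g = weighted_no_alarm_tendsto[OF mean]
  have "((\<lambda>B. (delay_sum prior m B / ennreal (ln B powr m)) * ennreal (inverse (?g B)))
      \<longlongrightarrow> ennreal (?S / I powr m) * ennreal (inverse ?S)) at_top"
    using S by (intro tendsto_mult_ennreal delay_sum_tendsto[OF I r m llr_upper llr_lower]
        tendsto_ennrealI tendsto_inverse g) auto
  also have "ennreal (?S / I powr m) * ennreal (inverse ?S) = ennreal (1 / I powr m)"
    using S by (simp add: ennreal_mult'[symmetric] field_simps)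
  finally show ?thesis
  proof (rule Lim_transform_eventually)
    show "\<forall>\<^sub>F B in at_top. (delay_sum prior m B / ennreal (ln B powr m)) * ennreal (inverse (?g B)) =
      cond_delay_moment Pinf P prior (T B) m / ennreal (ln B powr m)"
      \<comment> \<open>Once the normalization is positive, extended division by it is
        multiplication by its real inverse.\<close>
      using order_tendstoD(1)[OF g S]
      by eventually_elim (simp add: cond_delay_moment_def delay_sum_def divide_ennreal_def
          inverse_ennreal mult_ac)
  qed
qed

section \<open>Choice of the threshold from the false alarm level\<close>

text \<open>Weighting the bound \<open>real k / B\<close> by the prior gives
  \<open>prior_mean prior / B\<close>, which equals \<alpha> for this threshold when the mean is
  positive.\<close>

lemma SR_time_PFA_class:
  assumes mean: "summable (\<lambda>j. real (Suc j) * prior_at prior (Suc j))" and \<alpha>: "0 < \<alpha>"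
  shows "T (prior_mean prior / \<alpha>) \<in> PFA_class M mu X Pinf prior \<alpha>"
proof -
  interpret prob_space Pinf by (fact prob_space_Pinf)
  let ?B = "prior_mean prior / \<alpha>"
  have pm: "0 \<le> prior_mean prior" unfolding prior_mean_def by (intro suminf_nonneg mean) auto
  have "PFA Pinf prior (T ?B) \<le> \<alpha>"
  proof (cases "prior_mean prior = 0")
    \<comment> \<open>A zero mean makes the threshold 0 and the bound \<open>real k / B\<close>
      unusable; but then the prior has no mass on positive integers and every term of the false
      alarm sum vanishes.\<close>
    case True
    have "\<forall>j. real (Suc j) * prior_at prior (Suc j) = 0"
      using True suminf_eq_zero_iff[OF mean] by (simp add: prior_mean_def)
    then have "prior_at prior (Suc j) = 0" for j
      by (metis mult_eq_0_iff of_nat_eq_0_iff nat.distinct(1))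
    then show ?thesis using \<alpha> by (simp add: PFA_def del: of_nat_Suc)
  next
    case False
    with pm \<alpha> have B: "0 < ?B" by simp
    have le: "prior_at prior (Suc k) * \<P>(\<omega> in Pinf. T ?B \<omega> \<le> enat (Suc k))
        \<le> real (Suc k) * prior_at prior (Suc k) / ?B" for k
      using mult_left_mono[OF Pinf_SR_time_le[OF B, of "Suc k"], of "prior_at prior (Suc k)"]
      by (simp add: space_eq mult.commute del: of_nat_Suc)
    have sm: "summable (\<lambda>k. real (Suc k) * prior_at prior (Suc k) / ?B)"
      by (intro summable_divide mean)
    have "PFA Pinf prior (T ?B) \<le> (\<Sum>k. real (Suc k) * prior_at prior (Suc k) / ?B)"
      unfolding PFA_def
      by (intro suminf_le le sm summable_comparison_test'[OF sm])
         (use le in \<open>auto simp del: of_nat_Suc\<close>)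
    also have "\<dots> = prior_mean prior / ?B"
      unfolding prior_mean_def by (rule suminf_divide[OF mean])
    also have "\<dots> = \<alpha>" using False \<alpha> by simp
    finally show ?thesis .
  qed
  then show ?thesis by (simp add: PFA_class_def detection_procedure_SR_time)
qed

end

text \<open>The limit for the explicit threshold carries the condition
  \<open>0 < prior_mean prior\<close>: with zero mean the threshold is 0 for every \<alpha>, the
  alarm comes at time 1, and the moment does not grow.\<close>

theorem theorem4p1:
  fixes M :: "'w measure" and mu :: "'s measure"
    and X :: "nat \<Rightarrow> 'w \<Rightarrow> 's"
    and pinf :: "nat \<Rightarrow> (nat \<Rightarrow> 's) \<Rightarrow> 's \<Rightarrow> real"
    and p0 :: "nat \<Rightarrow> nat \<Rightarrow> (nat \<Rightarrow> 's) \<Rightarrow> 's \<Rightarrow> real"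
    and Pinf :: "'w measure" and P :: "nat \<Rightarrow> 'w measure"
    and prior :: "int pmf" and r I :: real
  assumes model: "changepoint_model M mu X pinf p0 Pinf P"
    and q_less_1: "measure_pmf.prob prior {..<0} < 1"
    and prior_mean_finite: "summable (\<lambda>j. real (Suc j) * prior_at prior (Suc j))"
    and r_ge_1: "1 \<le> r"
    and I_pos: "0 < I"
    and llr_upper: "\<And>\<epsilon> k. 0 < \<epsilon> \<Longrightarrow>
          (\<lambda>N. \<P>(\<omega> in P k. (1 + \<epsilon>) * I \<le> (MAX n\<in>{1..N}. llr X pinf p0 k n \<omega>) / real N))
            \<longlonglongrightarrow> 0"
    and llr_lower: "\<And>\<epsilon>. 0 < \<epsilon> \<Longrightarrow>
          (\<Sum>k. ennreal (prior_at prior k) * Upsilon X pinf p0 P I k r \<epsilon>) < \<infinity>"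
  shows
    "(\<forall>m. 0 < m \<and> m \<le> r \<longrightarrow>
       ((\<lambda>B. cond_delay_moment Pinf P prior (SR_time X pinf p0 B) m / ennreal (ln B powr m))
          \<longlongrightarrow> ennreal (1 / I powr m)) at_top) \<and>
     (\<forall>\<alpha>. 0 < \<alpha> \<and> \<alpha> < 1 \<longrightarrow>
       SR_time X pinf p0 (prior_mean prior / \<alpha>) \<in> PFA_class M mu X Pinf prior \<alpha>) \<and>
     (0 < prior_mean prior \<longrightarrow>
     (\<forall>m. 0 < m \<and> m \<le> r \<longrightarrow>
       ((\<lambda>\<alpha>. cond_delay_moment Pinf P prior (SR_time X pinf p0 (prior_mean prior / \<alpha>)) m
                / ennreal (\<bar>ln \<alpha>\<bar> powr m))
          \<longlongrightarrow> ennreal (1 / I powr m)) (at_right 0))) \<and>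
     (\<forall>b. (\<forall>\<alpha>. 0 < \<alpha> \<and> \<alpha> < 1 \<longrightarrow> 0 < b \<alpha> \<and> PFA Pinf prior (SR_time X pinf p0 (b \<alpha>)) \<le> \<alpha>) \<and>
         (\<lambda>\<alpha>. ln (b \<alpha>)) \<sim>[at_right 0] (\<lambda>\<alpha>. \<bar>ln \<alpha>\<bar>) \<longrightarrow>
     (\<forall>m. 0 < m \<and> m \<le> r \<longrightarrow>
       ((\<lambda>\<alpha>. cond_delay_moment Pinf P prior (SR_time X pinf p0 (b \<alpha>)) m
                / ennreal (\<bar>ln \<alpha>\<bar> powr m))
          \<longlongrightarrow> ennreal (1 / I powr m)) (at_right 0)))"
proof -
  interpret changepoint_model M mu X pinf p0 Pinf P by (rule model)
  have lim: "((\<lambda>B. cond_delay_moment Pinf P prior (SR_time X pinf p0 B) m / ennreal (ln B powr m))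
      \<longlongrightarrow> ennreal (1 / I powr m)) at_top" if "0 < m" "m \<le> r" for m
    using cond_delay_moment_tendsto[OF q_less_1 prior_mean_finite I_pos r_ge_1 that llr_upper
        llr_lower] .
  have part_ii: "((\<lambda>\<alpha>. cond_delay_moment Pinf P prior (SR_time X pinf p0 (prior_mean prior / \<alpha>)) m
      / ennreal (\<bar>ln \<alpha>\<bar> powr m)) \<longlongrightarrow> ennreal (1 / I powr m)) (at_right 0)"
    if pm: "0 < prior_mean prior" and m: "0 < m" "m \<le> r" for m
  proof (rule tendsto_at_right_0_rescale[OF lim[OF m]])
    show "\<forall>\<^sub>F \<alpha> in at_right 0. 0 < prior_mean prior / \<alpha>"
      using pm by (auto simp: eventually_at_right_less intro!: eventually_at_rightI[of 0 1])
    \<comment> \<open>For small \<alpha> the two sides differ by the constant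
      \<open>ln (prior_mean prior)\<close>.\<close>
    show "(\<lambda>\<alpha>. ln (prior_mean prior / \<alpha>)) \<sim>[at_right 0] (\<lambda>\<alpha>. \<bar>ln \<alpha>\<bar>)"
      using pm by real_asymp
  qed
  have part_b: "((\<lambda>\<alpha>. cond_delay_moment Pinf P prior (SR_time X pinf p0 (b \<alpha>)) m
      / ennreal (\<bar>ln \<alpha>\<bar> powr m)) \<longlongrightarrow> ennreal (1 / I powr m)) (at_right 0)"
    if b: "\<And>\<alpha>. 0 < \<alpha> \<Longrightarrow> \<alpha> < 1 \<Longrightarrow> 0 < b \<alpha>" "(\<lambda>\<alpha>. ln (b \<alpha>)) \<sim>[at_right 0] (\<lambda>\<alpha>. \<bar>ln \<alpha>\<bar>)"
      and m: "0 < m" "m \<le> r" for m and b :: "real \<Rightarrow> real"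
    by (rule tendsto_at_right_0_rescale[OF lim[OF m] _ b(2)])
       (auto intro!: eventually_at_rightI[of 0 1] b(1))
  show ?thesis
    using lim SR_time_PFA_class[OF prior_mean_finite] part_ii part_b by (intro conjI allI impI) blast+
qed

end
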